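(* Let $N \geq 3$, let $\mathbb{H}^N$ be the $N$-dimensional hyperbolic space, fix a point $o\in\mathbb{H}^N$ and set $r=r(x):=\varrho(x,o)$, the geodesic distance from $o$. Then for all $u \in C_c^\infty(\mathbb{H}^N)$ $$\int_{\mathbb{H}^N} |\nabla_{\mathbb{H}^N} u|^2 \, dv_{\mathbb{H}^N} - \frac{(N-1)^2}{4} \int_{\mathbb{H}^N} u^2 \, dv_{\mathbb{H}^N} \geq \frac{1}{4} \int_{\mathbb{H}^N} \frac{u^2}{r^2} \, dv_{\mathbb{H}^N} + \frac{(N-1)(N-3)}{4} \int_{\mathbb{H}^N} \frac{u^2}{\sinh^2 r} \, dv_{\mathbb{H}^N}.$$ Moreover, the operator $$H = -\Delta_{\mathbb{H}^N} - \frac{(N-1)^2}{4} - \frac{1}{4r^2} - \frac{(N-1)(N-3)}{4} \frac{1}{\sinh^2 r}$$ is critical in $\mathbb{H}^N\setminus\{o\}$; that is, the inequality $$\int_{\mathbb{H}^N} |\nabla_{\mathbb{H}^N} u|^2 \, dv_{\mathbb{H}^N} - \frac{(N-1)^2}{4} \int_{\mathbb{H}^N} u^2 \, dv_{\mathbb{H}^N} \geq \int_{\mathbb{H}^N} V u^2 \, dv_{\mathbb{H}^N} \quad \forall u \in C_c^\infty(\mathbb{H}^N\setminus\{o\})$$ is not valid for any $V > \frac{1}{4r^2} + \frac{(N-1)(N-3)}{4\sinh^2 r}$. In particular: no inequality of the form $\int_{\mathbb{H}^N} |\nabla_{\mathbb{H}^N} u|^2 dv_{\mathbb{H}^N} -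 \frac{(N-1)^2}{4}\int_{\mathbb{H}^N} u^2 dv_{\mathbb{H}^N} \ge c\int_{\mathbb{H}^N} \frac{u^2}{r^2} dv_{\mathbb{H}^N}$ holds for all $u\in C_c^\infty(\mathbb{H}^N)$ when $c>1/4$; and for every $\varepsilon>0$, no inequality of the form $$\int_{\mathbb{H}^N} |\nabla_{\mathbb{H}^N} u|^2 dv_{\mathbb{H}^N} - \frac{(N-1)^2}{4}\int_{\mathbb{H}^N} u^2 dv_{\mathbb{H}^N} \ge \frac14\int_{\mathbb{H}^N} \frac{u^2}{r^2} dv_{\mathbb{H}^N} + c\int_{\mathbb{H}^N} \frac{u^2}{\sinh^2 r} dv_{\mathbb{H}^N}$$ holds for all $u\in C_c^\infty(B_\varepsilon)$ when $c>(N-1)(N-3)/4$, where $B_\varepsilon=\{x\in\mathbb{H}^N:\varrho(x,o)<\varepsilon\}$.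
   Context: $\nabla_{\mathbb{H}^N}$, $\Delta_{\mathbb{H}^N}$, $dv_{\mathbb{H}^N}$ denote the Riemannian gradient, Laplace–Beltrami operator and volume measure of $\mathbb{H}^N$. A Schrödinger operator $P=-\Delta-V$ on a domain $\Omega$ is called critical in $\Omega$ (in the sense of Devyver–Fraas–Pinchover) if its quadratic form is nonnegative on $C_c^\infty(\Omega)$ and there is no nonnegative, not identically zero weight $W$ such that $\int_\Omega|\nabla u|^2-\int_\Omega Vu^2\ge\int_\Omega Wu^2$ for all $u\in C_c^\infty(\Omega)$. *)

theory Defs
  imports "HOL-Analysis.Analysis"
begin

text \<open>Model: the Poincare ball model of hyperbolic space H^N, i.e. the open unit
ball of real^'n (N = CARD('n)) with metric g = (2/(1-|x|^2))^2 times the Euclidean metric.\<close>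

definition hball :: "(real^'n) set" where
  "hball = ball 0 1"

definition hdist :: "real^'n \<Rightarrow> real^'n \<Rightarrow> real" where
  "hdist x y = arcosh (1 + 2 * (norm (x - y))^2 / ((1 - (norm x)^2) * (1 - (norm y)^2)))"

definition hdens :: "real^'n \<Rightarrow> real" where
  "hdens x = (2 / (1 - (norm x)^2)) ^ CARD('n)"

definition pderiv_i :: "(real^'n \<Rightarrow> real) \<Rightarrow> 'n \<Rightarrow> real^'n \<Rightarrow> real" where
  "pderiv_i f i x = frechet_derivative f (at x) (axis i 1)"

fun Ck :: "nat \<Rightarrow> (real^'n \<Rightarrow> real) \<Rightarrow> bool" where
  "Ck 0 f = continuous_on UNIV f"
| "Ck (Suc k) f = (f differentiable_on UNIV \<and> continuous_on UNIV f \<and> (\<forall>i. Ck k (pderiv_i f i)))"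

definition smooth_fun :: "(real^'n \<Rightarrow> real) \<Rightarrow> bool" where
  "smooth_fun f = (\<forall>k. Ck k f)"

text \<open>C_c^infinity(U) for an open U contained in the ball: smooth functions whose
support (closure of the nonzero set) is compact and contained in U (extended by 0).\<close>
definition test_funs :: "(real^'n) set \<Rightarrow> (real^'n \<Rightarrow> real) set" where
  "test_funs U = {u. smooth_fun u \<and> compact (closure {x. u x \<noteq> 0}) \<and> closure {x. u x \<noteq> 0} \<subseteq> U}"

definition hgrad_sq :: "(real^'n \<Rightarrow> real) \<Rightarrow> real^'n \<Rightarrow> real" where
  "hgrad_sq u x = ((1 - (norm x)^2) / 2)^2 * (\<Sum>i\<in>UNIV. (pderiv_i u i x)^2)"

text \<open>Integral with respect to the hyperbolic volume measure (functions vanishing outside the ball).\<close>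
definition hint :: "(real^'n \<Rightarrow> real) \<Rightarrow> real" where
  "hint f = integral\<^sup>L lborel (\<lambda>x. f x * hdens x)"

definition hQ :: "(real^'n \<Rightarrow> real) \<Rightarrow> (real^'n \<Rightarrow> real) \<Rightarrow> real" where
  "hQ V u = hint (hgrad_sq u) - hint (\<lambda>x. V x * (u x)^2)"

text \<open>Criticality (Devyver-Fraas-Pinchover) of -Delta_H - V in Omega.  The weight W is a
nonnegative measurable function not vanishing a.e. on Omega; the inequality with the
nonnegative integral means in particular that the integral of W u^2 is finite.\<close>
definition critical :: "(real^'n) set \<Rightarrow> (real^'n \<Rightarrow> real) \<Rightarrow> bool" where
  "critical \<Omega> V \<longleftrightarrow>
     (\<forall>u\<in>test_funs \<Omega>. 0 \<le> hQ V u) \<and>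
     \<not> (\<exists>W. W \<in> borel_measurable lborel \<and> (\<forall>x\<in>\<Omega>. 0 \<le> W x) \<and>
            \<not> (AE x in lborel. x \<in> \<Omega> \<longrightarrow> W x = 0) \<and>
            (\<forall>u\<in>test_funs \<Omega>.
               (\<integral>\<^sup>+ x. ennreal (W x * (u x)^2 * hdens x) \<partial>lborel) \<le> ennreal (hQ V u)))"

end

theory Submission
  imports Defs "HOL-Real_Asymp.Real_Asymp"
begin

text \<open>Let \<open>\<phi> = r powr (1/2) * sinh r powr (- (N - 1) / 2)\<close>, a positive solution of \<open>H \<phi> = 0\<close> away
  from the pole, and \<open>g = \<phi>' / \<phi>\<close>. Expanding \<open>|\<nabla>u - u g \<nabla>r|\<^sup>2 \<ge> 0\<close> and integrating the
  cross term by parts gives the inequality. For \<open>u = \<phi> \<chi>(r)\<close> the defect is exactly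
  \<open>\<integral> \<phi>\<^sup>2 \<chi>'(r)\<^sup>2 dv\<close>, that is, up to the area of the sphere, \<open>\<integral> (d\<chi>/ds)\<^sup>2 ds\<close> in the variable
  \<open>s = ln r\<close>; stretching a fixed bump by a factor \<open>k\<close> in \<open>s\<close> makes it of order \<open>1 / k\<close>, whereas
  \<open>\<integral> u\<^sup>2 / r\<^sup>2 dv\<close> is of order \<open>k\<close>. Centring the bump at \<open>0\<close>, \<open>2 k\<close> and \<open>- 2 k\<close> yields
  criticality and the two optimality statements.\<close>

subsection \<open>Differentiability classes on open sets\<close>

text \<open>The substitution \<open>u = v * sinh r powr (- (N - 1) / 2)\<close> absorbs the volume
  density: on radial functions \<open>- \<Delta>\<close> acts on \<open>v\<close> as \<open>- v'' +
  ((N - 1)^2 / 4 + (N - 1) * (N - 3) / (4 * (sinh r)^2)) * v\<close>. Removing these two terms and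
  \<open>1 / (4 * r^2)\<close> leaves the one-dimensional Hardy operator
  \<open>- v'' - v / (4 * r^2)\<close>, which annihilates \<open>sqrt r\<close>. This is the origin
  of \<phi> and of every constant in the statement. Two obstacles shape the proof. At the pole
  \<open>r\<close> is not smooth and \<phi> is unbounded, while a test function need not vanish
  there; hence smoothness is developed on open sets and all identities concern functions supported
  off the pole. Moreover no polar coordinates are used: \<open>cosh r\<close> is a rational function
  of the point, smooth even at the pole, with gradient of length \<open>sinh r\<close> and Laplacian
  \<open>N * cosh r\<close>, and each integral identity is the divergence theorem for a multiple of
  its gradient. The area of the sphere is never computed; it stays hidden in the constants
  \<open>bump_mass\<close> and \<open>dbump_mass\<close>.\<close>

fun Ck_on :: "nat \<Rightarrow> (real^'n) set \<Rightarrow> (real^'n \<Rightarrow> real) \<Rightarrow> bool" where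
  "Ck_on 0 S f = continuous_on S f"
| "Ck_on (Suc k) S f = ((\<forall>x\<in>S. f differentiable (at x)) \<and> (\<forall>i. Ck_on k S (pderiv_i f i)))"

text \<open>The derivative is quantified existentially, so smoothness of a concrete function is
  shown by exhibiting a family closed under differentiation and inducting on \<open>k\<close> with
  the family index free.\<close>

fun Ck_real :: "nat \<Rightarrow> real set \<Rightarrow> (real \<Rightarrow> real) \<Rightarrow> bool" where
  "Ck_real 0 S h = continuous_on S h"
| "Ck_real (Suc k) S h = (\<exists>h'. (\<forall>t\<in>S. (h has_real_derivative h' t) (at t)) \<and> Ck_real k S h')"

lemma pderiv_i_eqI: "(f has_derivative f') (at x) \<Longrightarrow> pderiv_i f i x = f' (axis i 1)"
  by (simp add: pderiv_i_def frechet_derivative_at[symmetric])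

lemma has_derivative_cong_open:
  assumes "open S" "x \<in> S" "\<And>y. y \<in> S \<Longrightarrow> f y = g y"
  shows "(f has_derivative f') (at x) \<longleftrightarrow> (g has_derivative f') (at x)"
proof
  assume "(f has_derivative f') (at x)"
  then show "(g has_derivative f') (at x)"
    by (rule has_derivative_transform_within_open[OF _ assms(1,2)]) (use assms(3) in auto)
next
  assume "(g has_derivative f') (at x)"
  then show "(f has_derivative f') (at x)"
    by (rule has_derivative_transform_within_open[OF _ assms(1,2)]) (use assms(3) in auto)
qed

text \<open>\<open>frechet_derivative\<close> chooses from the set of derivatives at the point.
  Locally equal functions have the same such set, so the choices agree even where it is
  empty.\<close>

lemma pderiv_i_cong_open:
  assumes "open S" "x \<in> S" "\<And>y. y \<in> S \<Longrightarrow> f y = g y"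
  shows "pderiv_i f i x = pderiv_i g i x"
  unfolding pderiv_i_def frechet_derivative_def
  using has_derivative_cong_open[OF assms] by simp

lemma differentiable_cong_open:
  assumes "open S" "x \<in> S" "\<And>y. y \<in> S \<Longrightarrow> f y = g y"
  shows "f differentiable (at x) \<longleftrightarrow> g differentiable (at x)"
  unfolding differentiable_def using has_derivative_cong_open[OF assms] by simp

lemma pderiv_i_eq_0_outside:
  assumes "closed K" "\<And>x. x \<notin> K \<Longrightarrow> f x = 0" "x \<notin> K"
  shows "pderiv_i f i x = 0"
proof -
  have "pderiv_i f i x = pderiv_i (\<lambda>x. 0) i x"
    by (rule pderiv_i_cong_open[of "- K"]) (use assms in auto)
  then show ?thesis by (simp add: pderiv_i_eqI[OF has_derivative_const])
qed

lemma pderiv_i_mult: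
  assumes "f differentiable (at x)" "g differentiable (at x)"
  shows "pderiv_i (\<lambda>x. f x * g x) i x = f x * pderiv_i g i x + pderiv_i f i x * g x"
proof -
  obtain f' g' where d: "(f has_derivative f') (at x)" "(g has_derivative g') (at x)"
    using assms unfolding differentiable_def by blast
  show ?thesis
    using pderiv_i_eqI[OF has_derivative_mult[OF d]] pderiv_i_eqI[OF d(1)] pderiv_i_eqI[OF d(2)]
    by simp
qed

lemma pderiv_i_add:
  assumes "f differentiable (at x)" "g differentiable (at x)"
  shows "pderiv_i (\<lambda>x. f x + g x) i x = pderiv_i f i x + pderiv_i g i x"
proof -
  obtain f' g' where d: "(f has_derivative f') (at x)" "(g has_derivative g') (at x)"
    using assms unfolding differentiable_def by blast
  show ?thesis
    using pderiv_i_eqI[OF has_derivative_add[OF d]] pderiv_i_eqI[OF d(1)] pderiv_i_eqI[OF d(2)]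
    by simp
qed

lemma has_derivative_real_compose:
  assumes "(h has_real_derivative h') (at (f x))" "(f has_derivative f') (at x)"
  shows "((\<lambda>x. h (f x)) has_derivative (\<lambda>v. h' * f' v)) (at x)"
  using has_derivative_compose[OF assms(2), of h "(*) h'"] assms(1)
  by (simp add: has_field_derivative_def)

lemma pderiv_i_compose:
  assumes "(h has_real_derivative h') (at (f x))" "f differentiable (at x)"
  shows "pderiv_i (\<lambda>x. h (f x)) i x = h' * pderiv_i f i x"
proof -
  obtain f' where d: "(f has_derivative f') (at x)"
    using assms unfolding differentiable_def by blast
  show ?thesis
    using pderiv_i_eqI[OF has_derivative_real_compose[OF assms(1) d]] pderiv_i_eqI[OF d] by simp
qed

lemma differentiable_real_compose:
  assumes "(h has_real_derivative h') (at (f x))" "f differentiable (at x)"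
  shows "(\<lambda>x. h (f x)) differentiable (at x)"
  using assms has_derivative_real_compose unfolding differentiable_def by blast

lemma Ck_on_cong:
  assumes "open S" "\<And>x. x \<in> S \<Longrightarrow> f x = g x"
  shows "Ck_on k S f \<longleftrightarrow> Ck_on k S g"
  using assms(2)
proof (induction k arbitrary: f g)
  case 0
  then show ?case by (auto intro: continuous_on_eq)
next
  case (Suc k)
  have "Ck_on k S (pderiv_i f i) = Ck_on k S (pderiv_i g i)" for i
    by (rule Suc.IH) (rule pderiv_i_cong_open[OF assms(1) _ Suc.prems])
  then show ?case
    using differentiable_cong_open[OF assms(1) _ Suc.prems] by auto
qed

lemma Ck_on_imp_continuous_on: "Ck_on k S f \<Longrightarrow> continuous_on S f"
  by (cases k) (auto intro!: continuous_at_imp_continuous_on differentiable_imp_continuous_within)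

lemma Ck_on_SucD: "Ck_on (Suc k) S f \<Longrightarrow> Ck_on k S f"
proof (induction k arbitrary: f)
  case 0
  then have "continuous_on S f" by (rule Ck_on_imp_continuous_on)
  then show ?case by simp
next
  case (Suc k)
  then have "Ck_on k S (pderiv_i f i)" for i by auto
  with Suc.prems show ?case by simp
qed

lemma Ck_on_1D: 
  assumes "Ck_on (Suc 0) S f"
  shows "x \<in> S \<Longrightarrow> f differentiable (at x)" "continuous_on S (pderiv_i f i)"
  using assms by auto

lemma Ck_eq_Ck_on_UNIV: "Ck k f \<longleftrightarrow> Ck_on k UNIV f"
  by (induction k arbitrary: f)
    (auto simp: differentiable_on_def intro!: continuous_at_imp_continuous_on differentiable_imp_continuous_within)

lemma Ck_on_mono: "Ck_on k T f \<Longrightarrow> S \<subseteq> T \<Longrightarrow> Ck_on k S f"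
  by (induction k arbitrary: f) (auto intro: continuous_on_subset)

lemma Ck_on_Un: "open S \<Longrightarrow> open T \<Longrightarrow> Ck_on k S f \<Longrightarrow> Ck_on k T f \<Longrightarrow> Ck_on k (S \<union> T) f"
  by (induction k arbitrary: f) (auto intro: continuous_on_open_Un)

lemma Ck_on_const: "Ck_on k S (\<lambda>x. c)"
proof (induction k arbitrary: c)
  case (Suc k)
  have "pderiv_i (\<lambda>x. c) i = (\<lambda>x. 0)" for i :: 'a
    by (rule ext, subst pderiv_i_eqI[OF has_derivative_const]) simp
  with Suc show ?case by simp
qed simp

lemma Ck_on_coord: "Ck_on k S (\<lambda>x. x $ i)"
proof (cases k)
  case (Suc k)
  have d: "((\<lambda>x. x $ i) has_derivative (\<lambda>v. v $ i)) (at x)" for x :: "real^'a"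
    by (rule bounded_linear_imp_has_derivative[OF bounded_linear_vec_nth])
  have "pderiv_i (\<lambda>x. x $ i) j = (\<lambda>x. axis j 1 $ i)" for j
    by (rule ext, subst pderiv_i_eqI[OF d]) simp
  then show ?thesis using Suc d by (auto simp: Ck_on_const differentiable_def)
qed (auto intro: continuous_intros)

lemma Ck_on_add:
  assumes "open S"
  shows "Ck_on k S f \<Longrightarrow> Ck_on k S g \<Longrightarrow> Ck_on k S (\<lambda>x. f x + g x)"
proof (induction k arbitrary: f g)
  case 0
  then show ?case by (auto intro: continuous_intros)
next
  case (Suc k)
  have "Ck_on k S (pderiv_i (\<lambda>x. f x + g x) i)" for i
  proof (subst Ck_on_cong[OF assms])
    show "\<And>x. x \<in> S \<Longrightarrow> pderiv_i (\<lambda>x. f x + g x) i x = pderiv_i f i x + pderiv_i g i x"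
      using Suc.prems by (intro pderiv_i_add) auto
    show "Ck_on k S (\<lambda>x. pderiv_i f i x + pderiv_i g i x)"
      using Suc by auto
  qed
  then show ?case using Suc.prems by (auto intro: differentiable_add)
qed

lemma Ck_on_mult:
  assumes "open S"
  shows "Ck_on k S f \<Longrightarrow> Ck_on k S g \<Longrightarrow> Ck_on k S (\<lambda>x. f x * g x)"
proof (induction k arbitrary: f g)
  case 0
  then show ?case by (auto intro: continuous_intros)
next
  case (Suc k)
  have "Ck_on k S (pderiv_i (\<lambda>x. f x * g x) i)" for i
  proof (subst Ck_on_cong[OF assms])
    show "\<And>x. x \<in> S \<Longrightarrow> pderiv_i (\<lambda>x. f x * g x) i x = f x * pderiv_i g i x + pderiv_i f i x * g x"
      using Suc.prems by (intro pderiv_i_mult) auto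
    show "Ck_on k S (\<lambda>x. f x * pderiv_i g i x + pderiv_i f i x * g x)"
      using Suc.prems Ck_on_SucD[OF Suc.prems(1)] Ck_on_SucD[OF Suc.prems(2)]
      by (intro Ck_on_add[OF assms] Suc.IH) auto
  qed
  then show ?case using Suc.prems by (auto intro: differentiable_mult)
qed

lemma Ck_on_compose:
  assumes "open S" "\<And>x. x \<in> S \<Longrightarrow> f x \<in> I"
  shows "Ck_real k I h \<Longrightarrow> Ck_on k S f \<Longrightarrow> Ck_on k S (\<lambda>x. h (f x))"
proof (induction k arbitrary: h)
  case 0
  then show ?case using assms(2) by (auto intro: continuous_on_compose2)
next
  case (Suc k)
  obtain h' where h': "\<And>t. t \<in> I \<Longrightarrow> (h has_real_derivative h' t) (at t)" "Ck_real k I h'"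
    using Suc.prems(1) by auto
  have "Ck_on k S (pderiv_i (\<lambda>x. h (f x)) i)" for i
  proof (subst Ck_on_cong[OF assms(1)])
    show "\<And>x. x \<in> S \<Longrightarrow> pderiv_i (\<lambda>x. h (f x)) i x = h' (f x) * pderiv_i f i x"
      using Suc.prems assms(2) h' by (intro pderiv_i_compose) auto
    show "Ck_on k S (\<lambda>x. h' (f x) * pderiv_i f i x)"
    proof (rule Ck_on_mult[OF assms(1)])
      show "Ck_on k S (\<lambda>x. h' (f x))"
        by (rule Suc.IH[OF h'(2) Ck_on_SucD[OF Suc.prems(2)]])
      show "Ck_on k S (pderiv_i f i)" using Suc.prems(2) by simp
    qed
  qed
  moreover have "(\<lambda>x. h (f x)) differentiable (at x)" if "x \<in> S" for x
    using differentiable_real_compose[of h "h' (f x)" f x] Suc.prems(2) that assms(2) h'(1) by simp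
  ultimately show ?case by simp
qed

text \<open>\<open>S\<close> and \<open>- K\<close> are open and cover the space, and
  \<open>f\<close> is identically 0 on the second. This turns functions built from \<open>r\<close>
  off the pole into globally smooth ones.\<close>

lemma Ck_on_extend_by_zero:
  assumes "open S" "Ck_on k S f" "closed K" "K \<subseteq> S" "\<And>x. x \<notin> K \<Longrightarrow> f x = 0"
  shows "Ck_on k UNIV f"
proof -
  have "Ck_on k (- K) f"
    using Ck_on_cong[of "- K" f "\<lambda>x. 0" k] assms(3,5) by (simp add: Ck_on_const open_Compl)
  then have "Ck_on k (S \<union> - K) f"
    using assms by (intro Ck_on_Un) auto
  moreover have "S \<union> - K = UNIV" using assms by auto
  ultimately show ?thesis by simp
qed

lemma Ck_on_diff: "open S \<Longrightarrow> Ck_on k S f \<Longrightarrow> Ck_on k S g \<Longrightarrow> Ck_on k S (\<lambda>x. f x - g x)"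
  using Ck_on_add[of S k f "\<lambda>x. -1 * g x"] Ck_on_mult[OF _ Ck_on_const, of S k g "-1"] by simp

lemma Ck_on_power: "open S \<Longrightarrow> Ck_on k S f \<Longrightarrow> Ck_on k S (\<lambda>x. f x ^ j)"
  by (induction j) (auto intro: Ck_on_mult Ck_on_const)

lemma Ck_on_sum: "open S \<Longrightarrow> (\<And>j. j \<in> J \<Longrightarrow> Ck_on k S (f j)) \<Longrightarrow> Ck_on k S (\<lambda>x. \<Sum>j\<in>J. f j x)"
  by (induction J rule: infinite_finite_induct) (auto intro: Ck_on_add Ck_on_const)

subsection \<open>Smooth functions of one real variable\<close>

lemma Ck_real_add: "Ck_real k S f \<Longrightarrow> Ck_real k S g \<Longrightarrow> Ck_real k S (\<lambda>x. f x + g x)"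
proof (induction k arbitrary: f g)
  case 0
  then show ?case by (auto intro: continuous_intros)
next
  case (Suc k)
  then obtain f' g' where "\<forall>t\<in>S. (f has_real_derivative f' t) (at t)" "Ck_real k S f'"
    "\<forall>t\<in>S. (g has_real_derivative g' t) (at t)" "Ck_real k S g'" by auto
  then show ?case using Suc.IH[of f' g'] by (auto intro!: exI[of _ "\<lambda>x. f' x + g' x"] DERIV_add)
qed

lemma Ck_real_cmult: "Ck_real k S f \<Longrightarrow> Ck_real k S (\<lambda>x. c * f x)"
proof (induction k arbitrary: f)
  case 0
  then show ?case by (auto intro: continuous_intros)
next
  case (Suc k)
  then obtain f' where "\<forall>t\<in>S. (f has_real_derivative f' t) (at t)" "Ck_real k S f'" by auto
  then show ?case using Suc.IH[of f'] by (auto intro!: exI[of _ "\<lambda>x. c * f' x"] DERIV_cmult)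
qed

lemma Ck_real_exp: "Ck_real k S exp"
proof (induction k)
  case (Suc k)
  then show ?case unfolding Ck_real.simps by (blast intro: DERIV_exp)
qed (auto intro: continuous_intros)

lemma Ck_real_inverse_power: "0 \<notin> S \<Longrightarrow> Ck_real k S (\<lambda>t. inverse t ^ Suc j)"
proof (induction k arbitrary: j)
  case 0
  then show ?case by (auto intro!: continuous_intros)
next
  case (Suc k)
  have "((\<lambda>t. inverse t ^ Suc j) has_real_derivative (- real (Suc j)) * inverse t ^ Suc (Suc j)) (at t)"
    if "t \<in> S" for t
  proof -
    have "t \<noteq> 0" using that Suc.prems by auto
    then show ?thesis
      by (auto intro!: derivative_eq_intros simp del: power_Suc) (simp add: algebra_simps)
  qed
  moreover have "Ck_real k S (\<lambda>t. (- real (Suc j)) * inverse t ^ Suc (Suc j))"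
    by (intro Ck_real_cmult Suc)
  ultimately show ?case
    unfolding Ck_real.simps
    by (intro exI[of _ "\<lambda>t. (- real (Suc j)) * inverse t ^ Suc (Suc j)"]) blast
qed

lemma Ck_real_inverse: "0 \<notin> S \<Longrightarrow> Ck_real k S inverse"
  using Ck_real_inverse_power[of S k 0] by simp

lemma Ck_real_ln: "Ck_real k {0<..} (ln :: real \<Rightarrow> real)"
proof (cases k)
  case (Suc k)
  then show ?thesis
    using Ck_real_inverse[of "{0<..}" k]
    by (auto intro!: exI[of _ inverse] DERIV_ln simp: divide_inverse)
qed (auto intro!: continuous_intros)

lemma Ck_real_sinh_cosh: "Ck_real k S (sinh :: real \<Rightarrow> real) \<and> Ck_real k S (cosh :: real \<Rightarrow> real)"
proof (induction k)
  case (Suc k)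
  have "\<forall>t\<in>S. (sinh has_real_derivative cosh t) (at t)" "\<forall>t\<in>S. (cosh has_real_derivative sinh t) (at t)"
    by (auto intro!: derivative_eq_intros)
  with Suc show ?case by auto
qed (auto intro: continuous_intros)

text \<open>The classical flat function \<open>exp (- 1 / t)\<close> with an extra factor
  \<open>t^(-j)\<close>. The powers close the family under differentiation up to linear
  combinations; later only \<open>j = 0\<close> (cutoff and bump) and \<open>j = 2\<close> (their
  derivatives) occur.\<close>

definition flat_exp :: "nat \<Rightarrow> real \<Rightarrow> real" where
  "flat_exp j t = (if t > 0 then inverse t ^ j * exp (- inverse t) else 0)"

lemma flat_exp_has_derivative:
  "(flat_exp j has_real_derivative (flat_exp (j + 2) t - real j * flat_exp (j + 1) t)) (at t)"
proof -
  consider "t > 0" | "t < 0" | "t = 0" by linarith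
  then show ?thesis
  proof cases
    case 1
    have "((\<lambda>t. inverse t ^ j * exp (- inverse t)) has_real_derivative
        (flat_exp (j + 2) t - real j * flat_exp (j + 1) t)) (at t)"
    proof -
      have "((\<lambda>t. inverse t ^ j) has_real_derivative
          real j * (- (inverse t ^ 2)) * inverse t ^ (j - 1)) (at t)"
        using 1 by (auto intro!: derivative_eq_intros simp: power2_eq_square)
      moreover have "real j * (- (inverse t ^ 2)) * inverse t ^ (j - 1) = - real j * inverse t ^ (j + 1)"
        by (cases j) (simp_all add: power2_eq_square algebra_simps)
      ultimately have "((\<lambda>t. inverse t ^ j) has_real_derivative (- real j * inverse t ^ (j + 1))) (at t)"
        by (simp only:)
      moreover have "((\<lambda>t. exp (- inverse t)) has_real_derivative inverse t ^ 2 * exp (- inverse t)) (at t)"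
        using 1 by (auto intro!: derivative_eq_intros simp: power2_eq_square)
      ultimately have "((\<lambda>t. inverse t ^ j * exp (- inverse t)) has_real_derivative
          - real j * inverse t ^ (j + 1) * exp (- inverse t) + inverse t ^ 2 * exp (- inverse t) * inverse t ^ j) (at t)"
        by (rule DERIV_mult)
      moreover have "- real j * inverse t ^ (j + 1) * exp (- inverse t) + inverse t ^ 2 * exp (- inverse t) * inverse t ^ j
          = flat_exp (j + 2) t - real j * flat_exp (j + 1) t"
        using 1 by (simp add: flat_exp_def power2_eq_square)
      ultimately show ?thesis by (simp only:)
    qed
    then show ?thesis
      by (rule has_field_derivative_transform_within_open[where S="{0<..}"])
        (use 1 in \<open>auto simp: flat_exp_def\<close>)
  next
    case 2
    have "((\<lambda>t. 0) has_real_derivative (flat_exp (j + 2) t - real j * flat_exp (j + 1) t)) (at t)"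
      using 2 by (simp add: flat_exp_def)
    then show ?thesis
      by (rule has_field_derivative_transform_within_open[where S="{..<0}"])
        (use 2 in \<open>auto simp: flat_exp_def\<close>)
  next
    case 3
    \<comment> \<open>The derivative at the origin must be 0. With \<open>z = 1 / y\<close> the
      right difference quotient is \<open>z^(j + 1) / exp z\<close>, which decays at infinity; the
      left one is identically 0.\<close>
    have R: "((\<lambda>y. flat_exp j y / y) \<longlongrightarrow> 0) (at_right 0)"
    proof (rule Lim_transform_eventually)
      have "((\<lambda>z::real. z ^ Suc j / exp z) \<longlongrightarrow> 0) at_top"
        by (rule tendsto_power_div_exp_0)
      then show "((\<lambda>y::real. inverse y ^ Suc j / exp (inverse y)) \<longlongrightarrow> 0) (at_right 0)"
        by (rule filterlim_compose[OF _ filterlim_inverse_at_top_right])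
      show "\<forall>\<^sub>F y in at_right 0. inverse y ^ Suc j / exp (inverse y) = flat_exp j y / y"
        using eventually_at_right_less[of "0::real"]
        by eventually_elim (simp add: flat_exp_def exp_minus field_simps)
    qed
    have L: "((\<lambda>y. flat_exp j y / y) \<longlongrightarrow> 0) (at_left 0)"
      by (rule Lim_transform_eventually[OF tendsto_const])
        (auto simp: flat_exp_def eventually_at_filter)
    have "(\<lambda>y. flat_exp j y / y) \<midarrow>0\<rightarrow> 0"
      using filterlim_split_at[OF L R] .
    with 3 show ?thesis
      by (simp add: has_field_derivative_iff flat_exp_def)
  qed
qed

lemma Ck_real_flat_exp: "Ck_real k S (flat_exp j)"
proof (induction k arbitrary: j)
  case 0
  show ?case
    using flat_exp_has_derivative by (auto intro!: continuous_at_imp_continuous_on DERIV_isCont)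
next
  case (Suc k)
  have "Ck_real k S (\<lambda>t. flat_exp (j + 2) t + (- real j) * flat_exp (j + 1) t)"
    by (intro Ck_real_add Ck_real_cmult Suc)
  then show ?case using flat_exp_has_derivative[of j]
    by (auto intro!: exI[of _ "\<lambda>t. flat_exp (j + 2) t + (- real j) * flat_exp (j + 1) t"])
qed

lemma flat_exp_0_mono: "s \<le> t \<Longrightarrow> flat_exp 0 s \<le> flat_exp 0 t"
  by (auto simp: flat_exp_def le_imp_inverse_le)

lemma flat_exp_nonneg: "0 \<le> flat_exp j t"
  by (auto simp: flat_exp_def)

lemma flat_exp_0_le_1: "flat_exp 0 t \<le> 1"
  by (auto simp: flat_exp_def)

lemma flat_exp_pos: "0 < t \<Longrightarrow> 0 < flat_exp j t"
  by (auto simp: flat_exp_def)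

lemma flat_exp_eq_0: "t \<le> 0 \<Longrightarrow> flat_exp j t = 0"
  by (auto simp: flat_exp_def)

subsection \<open>The divergence theorem for compactly supported functions\<close>

lemma integrable_compact_support:
  fixes f :: "real^'n \<Rightarrow> real"
  assumes "compact K" "continuous_on K f" "\<And>x. x \<notin> K \<Longrightarrow> f x = 0"
  shows "integrable lborel f"
proof -
  have "integrable lborel (\<lambda>x. indicator K x *\<^sub>R f x)"
    by (rule borel_integrable_compact[OF assms(1,2)])
  moreover have "(\<lambda>x. indicator K x *\<^sub>R f x) = f"
    using assms(3) by (auto simp: indicator_def fun_eq_iff)
  ultimately show ?thesis by simp
qed

text \<open>The integral of \<open>n (f (x + e\<^sub>i / n) - f x)\<close> vanishes by translation invariance, and the
  difference quotients converge boundedly.\<close>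

lemma integral_pderiv_eq_0:
  fixes f :: "real^'n \<Rightarrow> real"
  assumes f: "Ck_on (Suc 0) UNIV f" and K: "compact K" "\<And>x. x \<notin> K \<Longrightarrow> f x = 0"
  shows "integral\<^sup>L lborel (pderiv_i f i) = 0"
proof -
  note d = Ck_on_1D(1)[OF f, of _, simplified]
  note c = Ck_on_1D(2)[OF f, of i]
  have cf: "continuous_on UNIV f" using f Ck_on_imp_continuous_on by blast
  have p0: "pderiv_i f i x = 0" if "x \<notin> K" for x
    using pderiv_i_eq_0_outside[of K f x i] K that compact_imp_closed by auto
  have "bounded (pderiv_i f i ` K)"
    using c K by (intro compact_imp_bounded compact_continuous_image) (auto intro: continuous_on_subset)
  then obtain M where M: "\<And>x. x \<in> K \<Longrightarrow> \<bar>pderiv_i f i x\<bar> \<le> M" "0 < M"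
    unfolding bounded_pos by auto
  have M': "\<bar>pderiv_i f i x\<bar> \<le> M" for x
    using M p0[of x] by (cases "x \<in> K") auto
  obtain R where R: "\<And>x. x \<in> K \<Longrightarrow> norm x \<le> R" "0 < R"
    using compact_imp_bounded[OF K(1)] unfolding bounded_pos by auto
  have fi: "integrable lborel f"
    using K cf by (intro integrable_compact_support[of K]) (auto intro: continuous_on_subset)
  have fm: "f \<in> borel_measurable borel"
    using cf by (rule borel_measurable_continuous_onI)
  have line: "((\<lambda>t. f (x + t *\<^sub>R axis i 1)) has_real_derivative
      pderiv_i f i (x + t *\<^sub>R axis i 1)) (at t)" for x t
  proof -
    obtain f' where f': "(f has_derivative f') (at (x + t *\<^sub>R axis i 1))"
      using d unfolding differentiable_def by blast
    have "((\<lambda>t. x + t *\<^sub>R axis i 1) has_derivative (\<lambda>s. s *\<^sub>R axis i 1)) (at t)"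
      by (auto intro!: derivative_eq_intros)
    from has_derivative_compose[OF this f']
    have "((\<lambda>t. f (x + t *\<^sub>R axis i 1)) has_derivative (\<lambda>s. f' (s *\<^sub>R axis i 1))) (at t)" .
    moreover have "f' (s *\<^sub>R axis i 1) = s * pderiv_i f i (x + t *\<^sub>R axis i 1)" for s
      using linear_scale[OF has_derivative_linear[OF f']] pderiv_i_eqI[OF f', of i] by simp
    ultimately show ?thesis by (simp add: has_field_derivative_def mult.commute[of _ "pderiv_i f i _"] mult_commute_abs)
  qed
  define q where "q n x = (f (x + (1 / real (Suc n)) *\<^sub>R axis i 1) - f x) * real (Suc n)" for n x
  have shift: "integrable lborel (\<lambda>x. f (x + a))" "(\<integral>x. f (x + a) \<partial>lborel) = integral\<^sup>L lborel f" for a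
  proof -
    have e: "distr lborel borel ((+) a) = lborel" by (rule lborel_distr_plus)
    have "integrable (distr lborel borel ((+) a)) f" using fi e by simp
    then show "integrable lborel (\<lambda>x. f (x + a))"
      using fm by (subst (asm) integrable_distr_eq) (simp_all add: add.commute)
    have "integral\<^sup>L lborel f = integral\<^sup>L (distr lborel borel ((+) a)) f" using e by simp
    also have "\<dots> = (\<integral>x. f (a + x) \<partial>lborel)"
      by (rule integral_distr) (use fm in simp_all)
    finally show "(\<integral>x. f (x + a) \<partial>lborel) = integral\<^sup>L lborel f" by (simp add: add.commute)
  qed
  have q0: "integral\<^sup>L lborel (q n) = 0" for n
    unfolding q_def using shift fi by (simp add: Bochner_Integration.integral_diff)
  have qm: "q n \<in> borel_measurable lborel" for n
    unfolding q_def using shift(1) fi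
    by (intro borel_measurable_times borel_measurable_diff borel_measurable_const) auto
  have lim: "(\<lambda>n. q n x) \<longlonglongrightarrow> pderiv_i f i x" for x
  proof -
    have "((\<lambda>h. (f (x + h *\<^sub>R axis i 1) - f x) / h) \<longlongrightarrow> pderiv_i f i x) (at 0)"
      using line[of x 0] by (simp add: has_field_derivative_iff)
    moreover have "filterlim (\<lambda>n. 1 / real (Suc n)) (at 0) sequentially"
      using LIMSEQ_inverse_real_of_nat by (auto simp: filterlim_at inverse_eq_divide)
    ultimately have "(\<lambda>n. (f (x + (1 / real (Suc n)) *\<^sub>R axis i 1) - f x) / (1 / real (Suc n))) \<longlonglongrightarrow> pderiv_i f i x"
      by (rule filterlim_compose)
    then show ?thesis by (simp add: q_def)
  qed
  have bd: "norm (q n x) \<le> M * indicator (cball 0 (R + 1)) x" for n x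
  proof (cases "x \<in> cball 0 (R + 1)")
    case True
    obtain z where z: "f (x + (1 / real (Suc n)) *\<^sub>R axis i 1) - f (x + 0 *\<^sub>R axis i 1) =
        (1 / real (Suc n) - 0) * pderiv_i f i (x + z *\<^sub>R axis i 1)"
      using MVT2[of 0 "1 / real (Suc n)" "\<lambda>t. f (x + t *\<^sub>R axis i 1)"
          "\<lambda>t. pderiv_i f i (x + t *\<^sub>R axis i 1)"] line by auto
    then have "q n x = pderiv_i f i (x + z *\<^sub>R axis i 1)" by (simp add: q_def)
    then show ?thesis using M' True by simp
  next
    case False
    then have nx: "norm x > R + 1" by simp
    have "norm (x + e) \<ge> norm x - norm e" for e :: "real^'n"
      using norm_diff_ineq by blast
    moreover have "norm ((1 / real (Suc n)) *\<^sub>R (axis i 1 :: real^'n)) \<le> 1"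
      unfolding norm_scaleR norm_axis_1 by simp
    ultimately have "norm (x + (1 / real (Suc n)) *\<^sub>R axis i 1) > R"
      using nx by (smt (verit, best))
    then have "x + (1 / real (Suc n)) *\<^sub>R axis i 1 \<notin> K" "x \<notin> K"
      using R(1)[of "x + (1 / real (Suc n)) *\<^sub>R axis i 1"] R(1)[of x] nx by linarith+
    then show ?thesis using K False by (simp add: q_def)
  qed
  have "(\<lambda>n. integral\<^sup>L lborel (q n)) \<longlonglongrightarrow> integral\<^sup>L lborel (pderiv_i f i)"
  proof (rule integral_dominated_convergence[where w="\<lambda>x. M * indicator (cball 0 (R + 1)) x"])
    show "integrable lborel (\<lambda>x. M * indicator (cball 0 (R + 1)) x :: real)"
      using emeasure_lborel_cball_finite[of 0 "R + 1"]
      by (intro integrable_mult_right integrable_real_indicator) (auto simp: less_top)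
    show "pderiv_i f i \<in> borel_measurable lborel"
      using c by (simp add: borel_measurable_continuous_onI)
  qed (use lim bd qm in auto)
  then show ?thesis using q0 by (simp add: LIMSEQ_const_iff)
qed

subsection \<open>Polar geometry of the Poincare ball around a pole\<close>

lemma norm_diff_sq_has_derivative:
  "((\<lambda>x::real^'n. (norm (x - a))\<^sup>2) has_derivative (\<lambda>v. 2 * ((x - a) \<bullet> v))) (at x)"
  unfolding power2_norm_eq_inner
  by (auto intro!: derivative_eq_intros simp: inner_commute)

lemma Ck_on_norm_diff_sq: "open S \<Longrightarrow> Ck_on k S (\<lambda>x::real^'n. (norm (x - a))\<^sup>2)"
  unfolding power2_norm_eq_inner inner_vec_def inner_real_def vector_minus_component
  by (intro Ck_on_sum Ck_on_mult Ck_on_diff Ck_on_coord Ck_on_const)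

locale hyperbolic_pole =
  fixes x0 :: "real^'n"
  assumes dim_ge_3: "3 \<le> CARD('n)"
    and pole_in_hball: "x0 \<in> hball"
begin

definition \<Omega> :: "(real^'n) set" where "\<Omega> = hball - {x0}"

definition r :: "real^'n \<Rightarrow> real" where "r x = hdist x x0"

definition defect :: "real^'n \<Rightarrow> real" where "defect x = 1 - (norm x)\<^sup>2"

definition esq :: "real^'n \<Rightarrow> real" where "esq x = (norm (x - x0))\<^sup>2"

text \<open>This is \<open>cosh r\<close> on the ball. Being rational in the coordinates and smooth
  at the pole, it carries the differential computations, which are then transferred to
  \<open>r\<close>.\<close>

definition chr :: "real^'n \<Rightarrow> real" where "chr x = 1 + 2 * esq x / (defect x * defect x0)"

text \<open>The vector field \<open>chr_field\<close> is \<open>hdens\<close> times the hyperbolic gradient of \<open>cosh r\<close>; its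
  Euclidean divergence is \<open>hdens\<close> times the hyperbolic Laplacian of \<open>cosh r\<close>.\<close>

definition chr_field :: "'n \<Rightarrow> real^'n \<Rightarrow> real" where
  "chr_field i x = hdens x / defect x0 * ((x $ i - x0 $ i) * defect x + esq x * x $ i)"

lemma open_hball: "open (hball :: (real^'n) set)"
  by (simp add: hball_def)

lemma open_Omega: "open \<Omega>"
  by (simp add: \<Omega>_def hball_def open_delete)

lemma Omega_subset: "\<Omega> \<subseteq> hball"
  by (auto simp: \<Omega>_def)

lemma defect_pos: "x \<in> hball \<Longrightarrow> 0 < defect x"
  by (simp add: hball_def defect_def power_less_one_iff abs_square_less_1)

lemma defect_pole_pos: "0 < defect x0"
  using defect_pos pole_in_hball by blast

lemma esq_pos: "x \<in> \<Omega> \<Longrightarrow> 0 < esq x"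
  by (auto simp: \<Omega>_def esq_def)

lemma chr_ge_1: "x \<in> hball \<Longrightarrow> 1 \<le> chr x"
  using defect_pos[of x] defect_pole_pos by (simp add: chr_def esq_def)

lemma chr_gt_1: "x \<in> \<Omega> \<Longrightarrow> 1 < chr x"
  using defect_pos[of x] defect_pole_pos esq_pos Omega_subset by (auto simp: chr_def)

lemma r_eq_arcosh: "r x = arcosh (chr x)"
  by (simp add: r_def hdist_def chr_def defect_def esq_def)

lemma cosh_r: "x \<in> hball \<Longrightarrow> cosh (r x) = chr x"
  using chr_ge_1 by (simp add: r_eq_arcosh)

lemma r_nonneg: "x \<in> hball \<Longrightarrow> 0 \<le> r x"
  using chr_ge_1 by (simp add: r_eq_arcosh)

lemma r_pos: "x \<in> \<Omega> \<Longrightarrow> 0 < r x"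
  using chr_gt_1[of x] by (simp add: r_eq_arcosh)

lemma sinh_r_pos: "x \<in> \<Omega> \<Longrightarrow> 0 < sinh (r x)"
  using r_pos by simp

lemma sinh_r: "x \<in> \<Omega> \<Longrightarrow> sinh (r x) = sqrt ((chr x)\<^sup>2 - 1)"
  using chr_gt_1[of x] by (simp add: r_eq_arcosh sinh_arcosh_real)

lemma sinh_r_sq: "x \<in> \<Omega> \<Longrightarrow> (sinh (r x))\<^sup>2 = (chr x)\<^sup>2 - 1"
  using chr_gt_1[of x] by (simp add: sinh_r)

lemma hdens_pos: "x \<in> hball \<Longrightarrow> 0 < hdens (x :: real^'n)"
  using defect_pos[of x] by (simp add: hdens_def defect_def)

lemma defect_has_derivative: "(defect has_derivative (\<lambda>v. - 2 * (x \<bullet> v))) (at x)"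
  unfolding defect_def using norm_diff_sq_has_derivative[of 0 x]
  by (auto intro!: derivative_eq_intros)

lemma esq_has_derivative: "(esq has_derivative (\<lambda>v. 2 * ((x - x0) \<bullet> v))) (at x)"
  unfolding esq_def by (rule norm_diff_sq_has_derivative)

lemma Ck_on_defect: "open S \<Longrightarrow> Ck_on k S defect"
  unfolding defect_def using Ck_on_norm_diff_sq[of S k 0]
  by (auto intro!: Ck_on_diff Ck_on_const)

lemma Ck_on_esq: "open S \<Longrightarrow> Ck_on k S esq"
  unfolding esq_def by (rule Ck_on_norm_diff_sq)

lemma Ck_on_inverse_defect: "Ck_on k hball (\<lambda>x. inverse (defect x))"
proof (rule Ck_on_compose[OF open_hball, where I="{0<..}" and h=inverse])
  show "Ck_real k {0<..} (inverse :: real \<Rightarrow> real)" by (rule Ck_real_inverse) simp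
qed (use defect_pos Ck_on_defect open_hball in auto)

lemma hdens_eq: "hdens = (\<lambda>x :: real^'n. (2 * inverse (defect x)) ^ CARD('n))"
  by (simp add: hdens_def defect_def divide_inverse fun_eq_iff)

lemma Ck_on_hdens: "Ck_on k hball (hdens :: real^'n \<Rightarrow> real)"
  unfolding hdens_eq
  by (intro Ck_on_power Ck_on_mult Ck_on_const open_hball Ck_on_inverse_defect)

lemma Ck_on_chr: "Ck_on k hball chr"
proof -
  have "chr = (\<lambda>x. 1 + 2 / defect x0 * (esq x * inverse (defect x)))"
    by (auto simp: chr_def field_simps)
  then show ?thesis
    by (simp only:) (intro Ck_on_add Ck_on_mult Ck_on_const open_hball Ck_on_inverse_defect Ck_on_esq)
qed

lemma Ck_on_chr_field: "Ck_on k hball (chr_field i)"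
  unfolding chr_field_def divide_inverse
  by (intro Ck_on_add Ck_on_diff Ck_on_mult Ck_on_const Ck_on_coord open_hball Ck_on_hdens Ck_on_esq Ck_on_defect)

text \<open>Uses \<open>arcosh c = ln (c + sqrt (c^2 - 1))\<close> with the root written as
  \<open>exp (1/2 * ln (c^2 - 1))\<close>, so that smoothness of \<open>ln\<close> and
  \<open>exp\<close> suffices. Off the pole \<open>c > 1\<close> keeps both logarithms in their
  domain.\<close>

lemma Ck_on_r: "Ck_on k \<Omega> r"
proof -
  have C: "Ck_on k \<Omega> chr" using Ck_on_mono[OF Ck_on_chr Omega_subset] .
  have ln: "Ck_real k {0<..} (ln :: real \<Rightarrow> real)" by (rule Ck_real_ln)
  have ex: "Ck_real k UNIV (exp :: real \<Rightarrow> real)" by (rule Ck_real_exp)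
  have g: "(chr x)\<^sup>2 - 1 > 0" if "x \<in> \<Omega>" for x
    using chr_gt_1[OF that] by (simp add: power2_eq_square algebra_simps less_1_mult)
  have 1: "Ck_on k \<Omega> (\<lambda>x. ln ((chr x)\<^sup>2 - 1))"
    by (rule Ck_on_compose[OF open_Omega _ ln])
      (use g in \<open>auto intro!: Ck_on_diff Ck_on_power open_Omega C Ck_on_const\<close>)
  have 2: "Ck_on k \<Omega> (\<lambda>x. exp (1/2 * ln ((chr x)\<^sup>2 - 1)))"
    by (rule Ck_on_compose[OF open_Omega _ ex], simp)
      (intro Ck_on_mult open_Omega 1 Ck_on_const)
  have "Ck_on k \<Omega> (\<lambda>x. ln (chr x + exp (1/2 * ln ((chr x)\<^sup>2 - 1))))"
  proof (rule Ck_on_compose[OF open_Omega _ ln])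
    show "chr x + exp (1/2 * ln ((chr x)\<^sup>2 - 1)) \<in> {0<..}" if "x \<in> \<Omega>" for x
      using chr_gt_1[OF that] by (auto intro!: add_pos_pos)
    show "Ck_on k \<Omega> (\<lambda>x. chr x + exp (1/2 * ln ((chr x)\<^sup>2 - 1)))"
      by (rule Ck_on_add[OF open_Omega C 2])
  qed
  moreover have "r x = ln (chr x + exp (1/2 * ln ((chr x)\<^sup>2 - 1)))" if "x \<in> \<Omega>" for x
  proof -
    have "exp (1/2 * ln ((chr x)\<^sup>2 - 1)) = sqrt ((chr x)\<^sup>2 - 1)"
      using g[OF that] by (simp add: powr_half_sqrt[symmetric] powr_def)
    then show ?thesis
      using chr_gt_1[OF that] by (simp add: r_eq_arcosh arcosh_real_def)
  qed
  ultimately show ?thesis using Ck_on_cong[OF open_Omega, of r] by auto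
qed

lemma continuous_on_r: "continuous_on \<Omega> r"
  using Ck_on_r Ck_on_imp_continuous_on by blast

lemma continuous_on_hdens: "continuous_on hball (hdens :: real^'n \<Rightarrow> real)"
  using Ck_on_hdens Ck_on_imp_continuous_on by blast

lemma r_differentiable: "x \<in> \<Omega> \<Longrightarrow> r differentiable (at x)"
  using Ck_on_1D(1)[OF Ck_on_r] .

lemma pderiv_chr:
  assumes "x \<in> hball"
  shows "pderiv_i chr i x = 4 / (defect x0 * (defect x)\<^sup>2) * ((x $ i - x0 $ i) * defect x + esq x * x $ i)"
proof -
  note p = defect_pos[OF assms] defect_pole_pos
  have "(chr has_derivative (\<lambda>v. 4 / (defect x0 * (defect x)\<^sup>2) * (((x - x0) \<bullet> v) * defect x + esq x * (x \<bullet> v)))) (at x)"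
    unfolding chr_def using p
    by (auto intro!: derivative_eq_intros defect_has_derivative esq_has_derivative
        simp: fun_eq_iff power2_eq_square field_simps)
  from pderiv_i_eqI[OF this, of i] show ?thesis
    by (simp add: inner_axis)
qed

lemma chr_field_eq:
  assumes "x \<in> hball"
  shows "chr_field i x = hdens x * (defect x / 2)\<^sup>2 * pderiv_i chr i x"
  using defect_pos[OF assms] defect_pole_pos
  by (simp add: pderiv_chr[OF assms] chr_field_def power2_eq_square field_simps)

lemma pderiv_r:
  assumes "x \<in> \<Omega>"
  shows "pderiv_i r i x = pderiv_i chr i x / sinh (r x)"
proof -
  have "(arcosh has_real_derivative 1 / sinh (r x)) (at (chr x))"
    using chr_gt_1[OF assms] sinh_r[OF assms] by (auto intro!: derivative_eq_intros)
  moreover have "chr differentiable (at x)"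
    using Ck_on_1D(1)[OF Ck_on_chr] assms Omega_subset by auto
  ultimately show ?thesis
    using pderiv_i_compose[of arcosh "1 / sinh (r x)" chr x i] by (simp add: r_eq_arcosh[abs_def])
qed

text \<open>Polarization. With the next two lemmas it reduces every coordinate sum below to the
  three scalars \<open>defect x0\<close>, \<open>defect x\<close> and \<open>esq x\<close>.\<close>

lemma inner_shift: "2 * (\<Sum>i\<in>UNIV. x $ i * (x $ i - x0 $ i)) = defect x0 - defect x + esq x"
proof -
  have "2 * (x \<bullet> (x - x0)) = defect x0 - defect x + esq x"
    by (simp add: defect_def esq_def power2_norm_eq_inner inner_diff inner_commute algebra_simps)
  then show ?thesis by (simp add: inner_vec_def)
qed

lemma sum_coord_sq: "(\<Sum>i\<in>UNIV. (x $ i)\<^sup>2) = 1 - defect x"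
  unfolding defect_def power2_norm_eq_inner by (simp add: inner_vec_def power2_eq_square)

lemma sum_shift_sq: "(\<Sum>i\<in>UNIV. (x $ i - x0 $ i)\<^sup>2) = esq x"
  unfolding esq_def power2_norm_eq_inner by (simp add: inner_vec_def power2_eq_square)

text \<open>The hyperbolic gradient of \<open>cosh r\<close> has length \<open>sinh r\<close>,
  written without \<open>r\<close> so that it also covers the pole. The computation rests on the
  collapse of the coordinate sum to \<open>e * (a * b + e)\<close>.\<close>

lemma grad_chr_sq:
  assumes "x \<in> hball"
  shows "(defect x / 2)\<^sup>2 * (\<Sum>i\<in>UNIV. (pderiv_i chr i x)\<^sup>2) = (chr x)\<^sup>2 - 1"
proof -
  define a b e where "a = defect x0" and "b = defect x" and "e = esq x"
  note p = defect_pos[OF assms, folded b_def] defect_pole_pos[folded a_def]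
  have "((x $ i - x0 $ i) * b + e * x $ i)\<^sup>2
      = b\<^sup>2 * (x $ i - x0 $ i)\<^sup>2 + b * e * 2 * (x $ i * (x $ i - x0 $ i)) + e\<^sup>2 * (x $ i)\<^sup>2" for i
    by (simp add: power2_eq_square algebra_simps)
  then have "(\<Sum>i\<in>UNIV. ((x $ i - x0 $ i) * b + e * x $ i)\<^sup>2)
      = b\<^sup>2 * e + b * e * (a - b + e) + e\<^sup>2 * (1 - b)"
    using inner_shift[of x] sum_coord_sq[of x] sum_shift_sq[of x]
    by (simp add: sum.distrib sum_distrib_left[symmetric] mult.assoc a_def[symmetric] b_def[symmetric] e_def[symmetric])
  then have S: "(\<Sum>i\<in>UNIV. ((x $ i - x0 $ i) * b + e * x $ i)\<^sup>2) = e * (a * b + e)"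
    by (simp add: power2_eq_square algebra_simps)
  have "(\<Sum>i\<in>UNIV. (pderiv_i chr i x)\<^sup>2) = (4 / (a * b\<^sup>2))\<^sup>2 * (e * (a * b + e))"
    by (simp only: pderiv_chr[OF assms] power_mult_distrib sum_distrib_left[symmetric]
        S[unfolded a_def b_def e_def] a_def b_def e_def)
  moreover have "(b / 2)\<^sup>2 * ((4 / (a * b\<^sup>2))\<^sup>2 * (e * (a * b + e))) = (1 + 2 * e / (b * a))\<^sup>2 - 1"
    using p by (simp add: field_simps power2_eq_square)
  ultimately show ?thesis by (simp add: chr_def a_def b_def e_def)
qed

lemma chr_field_eq_r:
  assumes "x \<in> \<Omega>"
  shows "chr_field i x = hdens x * (defect x / 2)\<^sup>2 * sinh (r x) * pderiv_i r i x"
  using assms sinh_r_pos[OF assms] Omega_subset by (auto simp: chr_field_eq pderiv_r)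

text \<open>Since the gradient of \<open>r\<close> is that of \<open>cosh r\<close> divided by
  \<open>sinh r\<close>, \<open>grad_chr_sq\<close> gives length 1.\<close>

lemma eikonal:
  assumes "x \<in> \<Omega>"
  shows "(defect x / 2)\<^sup>2 * (\<Sum>i\<in>UNIV. (pderiv_i r i x)\<^sup>2) = 1"
proof -
  have "(defect x / 2)\<^sup>2 * (\<Sum>i\<in>UNIV. (pderiv_i r i x)\<^sup>2)
      = (defect x / 2)\<^sup>2 * (\<Sum>i\<in>UNIV. (pderiv_i chr i x)\<^sup>2) / (sinh (r x))\<^sup>2"
    by (simp add: pderiv_r[OF assms] power_divide sum_divide_distrib[symmetric])
  also have "\<dots> = 1"
    using grad_chr_sq[of x] assms Omega_subset sinh_r_sq[OF assms] sinh_r_pos[OF assms] by auto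
  finally show ?thesis .
qed

lemma radial_pairing:
  assumes "x \<in> \<Omega>"
  shows "(\<Sum>i\<in>UNIV. pderiv_i r i x * chr_field i x) = hdens x * sinh (r x)"
proof -
  have "(\<Sum>i\<in>UNIV. pderiv_i r i x * chr_field i x)
      = (\<Sum>i\<in>UNIV. hdens x * sinh (r x) * (defect x / 2)\<^sup>2 * (pderiv_i r i x)\<^sup>2)"
    by (intro sum.cong) (auto simp: chr_field_eq_r[OF assms] power2_eq_square)
  also have "\<dots> = hdens x * sinh (r x) * ((defect x / 2)\<^sup>2 * (\<Sum>i\<in>UNIV. (pderiv_i r i x)\<^sup>2))"
    by (simp add: sum_distrib_left mult.assoc)
  finally show ?thesis by (simp add: eikonal[OF assms])
qed

text \<open>Geometrically, the Laplacian of \<open>cosh r\<close> is \<open>N * cosh r\<close>.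
  Together with \<open>grad_chr_sq\<close> this is the geometric input of all the integral
  identities.\<close>

lemma div_chr_field:
  assumes "x \<in> hball"
  shows "(\<Sum>i\<in>UNIV. pderiv_i (chr_field i) i x) = real CARD('n) * hdens x * chr x"
proof -
  define a b e where "a = defect x0" and "b = defect x" and "e = esq x"
  note p = defect_pos[OF assms, folded b_def] defect_pole_pos[folded a_def]
  have hd: "(hdens has_derivative (\<lambda>v. hdens x * (2 * real CARD('n) / b) * (x \<bullet> v))) (at x)"
  proof -
    obtain m where m: "CARD('n) = Suc m" by (cases "CARD('n)") auto
    have "((\<lambda>t. (2 * inverse t) ^ CARD('n)) has_real_derivative - (real CARD('n) / b) * hdens x) (at (defect x))"
      unfolding hdens_eq using p unfolding m b_def[symmetric]
      by (auto intro!: derivative_eq_intros simp: field_simps) (cases m; simp)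
    from has_derivative_real_compose[OF this defect_has_derivative]
    show ?thesis unfolding hdens_eq by (simp add: algebra_simps)
  qed
  have "pderiv_i (chr_field i) i x
      = hdens x / a * (2 * real CARD('n) / b * (b * (x $ i * (x $ i - x0 $ i)) + e * (x $ i)\<^sup>2) + (b + e))" for i
  proof -
    have "(chr_field i has_derivative (\<lambda>v. (hdens x * (2 * real CARD('n) / b) * (x \<bullet> v)) / a * ((x $ i - x0 $ i) * b + e * x $ i)
        + hdens x / a * (v $ i * b + (x $ i - x0 $ i) * (- 2 * (x \<bullet> v)) + 2 * ((x - x0) \<bullet> v) * x $ i + e * v $ i))) (at x)"
      unfolding chr_field_def a_def b_def e_def
      using p by (auto intro!: derivative_eq_intros defect_has_derivative esq_has_derivative hd
        bounded_linear_imp_has_derivative bounded_linear_vec_nth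
        simp: fun_eq_iff a_def b_def e_def inner_diff field_simps)
    from pderiv_i_eqI[OF this, of i] show ?thesis
      by (simp add: inner_axis power2_eq_square) (simp add: algebra_simps add_divide_distrib)
  qed
  then have "(\<Sum>i\<in>UNIV. pderiv_i (chr_field i) i x) = hdens x / a * (\<Sum>i\<in>UNIV.
      (2 * real CARD('n) / b * (b * (x $ i * (x $ i - x0 $ i)) + e * (x $ i)\<^sup>2) + (b + e)))"
    by (simp only: sum_distrib_left)
  also have "(\<Sum>i\<in>UNIV. (2 * real CARD('n) / b * (b * (x $ i * (x $ i - x0 $ i)) + e * (x $ i)\<^sup>2) + (b + e)))
      = 2 * real CARD('n) / b * (b * ((a - b + e) / 2) + e * (1 - b)) + real CARD('n) * (b + e)"
  proof -
    have "(\<Sum>i\<in>UNIV. x $ i * (x $ i - x0 $ i)) = (a - b + e) / 2" "(\<Sum>i\<in>UNIV. (x $ i)\<^sup>2) = 1 - b"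
      using inner_shift[of x] sum_coord_sq[of x] by (simp_all add: a_def b_def e_def)
    then show ?thesis
      by (simp only: sum.distrib sum_distrib_left[symmetric] sum_constant distrib_left)
  qed
  also have "hdens x / a * \<dots> = real CARD('n) * hdens x * (1 + 2 * e / (b * a))"
    using p by (simp add: field_simps)
  finally show ?thesis by (simp add: chr_def a_def b_def e_def)
qed

end

subsection \<open>The ground state in one variable\<close>

text \<open>The logarithmic derivative of the ground state \<open>t powr (1/2) * sinh t powr (- (d - 1) / 2)\<close>.\<close>

definition ground_logder :: "real \<Rightarrow> real \<Rightarrow> real" where
  "ground_logder d t = 1 / (2 * t) - (d - 1) / 2 * (cosh t / sinh t)"

text \<open>The whole potential of \<open>H\<close>, including the constant
  \<open>(d - 1)^2 / 4\<close> coming from the bottom of the spectrum.\<close>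

definition hardy_pot :: "real \<Rightarrow> real \<Rightarrow> real" where
  "hardy_pot d t = (d - 1)\<^sup>2 / 4 + 1 / (4 * t\<^sup>2) + (d - 1) * (d - 3) / 4 / (sinh t)\<^sup>2"

lemma ground_logder_has_derivative:
  assumes "t > 0"
  shows "(ground_logder d has_real_derivative (- 1 / (2 * t\<^sup>2) + (d - 1) / 2 / (sinh t)\<^sup>2)) (at t)"
proof -
  have s: "sinh t > 0" using assms by simp
  have c: "cosh t * cosh t = 1 + sinh t * sinh t"
    using cosh_square_eq[of t] by (simp add: power2_eq_square)
  have "((\<lambda>t. cosh t / sinh t) has_real_derivative (- 1 / (sinh t)\<^sup>2)) (at t)"
    using s c by (auto intro!: derivative_eq_intros simp: power2_eq_square field_simps)
  moreover have "((\<lambda>t. 1 / (2 * t)) has_real_derivative (- 1 / (2 * t\<^sup>2))) (at t)"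
    using assms by (auto intro!: derivative_eq_intros simp: power2_eq_square field_simps)
  ultimately have "((\<lambda>t. 1 / (2 * t) - (d - 1) / 2 * (cosh t / sinh t)) has_real_derivative
      - 1 / (2 * t\<^sup>2) - (d - 1) / 2 * (- 1 / (sinh t)\<^sup>2)) (at t)"
    by (intro DERIV_diff DERIV_cmult)
  then show ?thesis unfolding ground_logder_def by simp
qed

text \<open>The radial equation
  \<open>\<phi>'' + (d - 1) * coth t * \<phi>' + V * \<phi> = 0\<close> divided by \<phi>, with
  \<open>\<phi>'' / \<phi> = g' + g^2\<close>. In terms of \<open>1 / t\<close>,
  \<open>coth t\<close> and \<open>1 / (sinh t)^2\<close> it reduces to
  \<open>coth^2 = 1 + 1 / sinh^2\<close>.\<close>

lemma ground_logder_riccati: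
  assumes "t > 0"
  shows "(- 1 / (2 * t\<^sup>2) + (d - 1) / 2 / (sinh t)\<^sup>2) + (d - 1) * (cosh t / sinh t) * ground_logder d t
    = - hardy_pot d t - (ground_logder d t)\<^sup>2"
proof -
  have s: "sinh t > 0" using assms by simp
  define q where "q = cosh t / sinh t"
  define z where "z = 1 / (sinh t)\<^sup>2"
  define y where "y = 1 / t"
  have q2: "q\<^sup>2 = 1 + z"
    using s by (simp add: q_def z_def power_divide cosh_square_eq add_divide_distrib)
  have e: "ground_logder d t = y / 2 - (d - 1) / 2 * q"
    by (simp add: ground_logder_def q_def y_def)
  have p: "hardy_pot d t = (d - 1)\<^sup>2 / 4 + y\<^sup>2 / 4 + (d - 1) * (d - 3) / 4 * z"
    by (simp add: hardy_pot_def z_def y_def power_divide)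
  have l: "- 1 / (2 * t\<^sup>2) + (d - 1) / 2 / (sinh t)\<^sup>2 = - (y\<^sup>2 / 2) + (d - 1) / 2 * z"
    by (simp add: z_def y_def power_divide)
  have "(- (y\<^sup>2 / 2) + (d - 1) / 2 * z) + (d - 1) * q * (y / 2 - (d - 1) / 2 * q)
      + (y / 2 - (d - 1) / 2 * q)\<^sup>2 + ((d - 1)\<^sup>2 / 4 + y\<^sup>2 / 4 + (d - 1) * (d - 3) / 4 * z)
      = (d - 1)\<^sup>2 / 4 * (1 + z - q\<^sup>2)"
    by (simp add: power2_eq_square field_simps)
  also have "\<dots> = 0" by (simp add: q2)
  finally show ?thesis unfolding e p l q_def[symmetric] by linarith
qed

lemma sinh_le_mult_cosh:
  assumes "0 \<le> (t::real)"
  shows "sinh t \<le> t * cosh t"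
proof -
  have "(\<lambda>t. t * cosh t - sinh t) 0 \<le> (\<lambda>t. t * cosh t - sinh t) t"
  proof (rule DERIV_nonneg_imp_nondecreasing[OF assms])
    fix x :: real assume "0 \<le> x" "x \<le> t"
    moreover have "((\<lambda>t. t * cosh t - sinh t) has_real_derivative x * sinh x) (at x)"
      by (auto intro!: derivative_eq_intros)
    ultimately show "\<exists>y. ((\<lambda>t. t * cosh t - sinh t) has_real_derivative y) (at x) \<and> 0 \<le> y"
      by (auto intro!: exI[of _ "x * sinh x"])
  qed
  then show ?thesis by simp
qed

text \<open>From \<open>1 / t \<le> coth t\<close> and \<open>d - 1 \<ge> 1\<close>. Thus the ground
  state decreases along \<open>r\<close>, which fixes the sign of the error made by cutting off at
  the pole.\<close>

lemma ground_logder_nonpos: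
  assumes "t > 0" "d \<ge> 2"
  shows "ground_logder d t \<le> 0"
proof -
  have s: "sinh t > 0" using assms by simp
  have "1 / t \<le> cosh t / sinh t"
    using sinh_le_mult_cosh[of t] s assms by (simp add: field_simps)
  also have "\<dots> \<le> (d - 1) * (cosh t / sinh t)"
    using s assms by (intro mult_right_mono[of 1 "d - 1", simplified]) auto
  finally have "1 / t / 2 \<le> (d - 1) * (cosh t / sinh t) / 2" by (rule divide_right_mono) simp
  then show ?thesis by (simp add: ground_logder_def mult.commute)
qed

lemma hardy_pot_nonneg: "d \<ge> 3 \<Longrightarrow> 0 \<le> hardy_pot d t"
  by (simp add: hardy_pot_def)

lemma continuous_on_hardy_pot: "continuous_on {0<..} (hardy_pot d)"
  unfolding hardy_pot_def by (auto intro!: continuous_intros)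

lemma continuous_on_ground_logder: "continuous_on {0<..} (ground_logder d)"
  unfolding ground_logder_def by (auto intro!: continuous_intros)

subsection \<open>Integration by parts along the radial direction\<close>

context hyperbolic_pole
begin

text \<open>\<open>I\<close> is the Euclidean divergence of the field \<open>W * chr_field\<close>,
  extended by zero from \<Omega>; its zero-order term is the divergence of
  \<open>chr_field\<close>.\<close>

lemma integral_div_chr_field:
  assumes W: "Ck_on (Suc 0) \<Omega> W" and K: "compact K" "K \<subseteq> \<Omega>" "\<And>x. x \<notin> K \<Longrightarrow> W x = 0"
  defines "I \<equiv> \<lambda>x. (\<Sum>i\<in>UNIV. pderiv_i W i x * chr_field i x) + real CARD('n) * (W x * hdens x * chr x)"
  shows "integrable lborel I" "integral\<^sup>L lborel I = 0"
proof -
  define f where "f i x = W x * chr_field i x" for i x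
  have cf: "Ck_on (Suc 0) \<Omega> (chr_field i)" for i
    using Ck_on_mono[OF Ck_on_chr_field Omega_subset] .
  have fO: "Ck_on (Suc 0) \<Omega> (f i)" for i
    unfolding f_def by (rule Ck_on_mult[OF open_Omega W cf])
  have f0: "f i x = 0" if "x \<notin> K" for i x using K(3)[OF that] by (simp add: f_def)
  have fU: "Ck_on (Suc 0) UNIV (f i)" for i
    using Ck_on_extend_by_zero[OF open_Omega fO compact_imp_closed[OF K(1)] K(2)] f0 by blast
  have p0: "pderiv_i (f i) i x = 0" "pderiv_i W i x = 0" if "x \<notin> K" for i x
    using pderiv_i_eq_0_outside[OF compact_imp_closed[OF K(1)]] f0 K(3) that by blast+
  have int: "integrable lborel (pderiv_i (f i) i)" for i
    using Ck_on_1D(2)[OF fU[of i], of i] p0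
    by (intro integrable_compact_support[OF K(1)]) (auto intro: continuous_on_subset)
  have I: "I = (\<lambda>x. \<Sum>i\<in>UNIV. pderiv_i (f i) i x)"
  proof
    fix x
    show "I x = (\<Sum>i\<in>UNIV. pderiv_i (f i) i x)"
    proof (cases "x \<in> K")
      case True
      then have x: "x \<in> \<Omega>" "x \<in> hball" using K(2) Omega_subset by auto
      have "pderiv_i (f i) i x = W x * pderiv_i (chr_field i) i x + pderiv_i W i x * chr_field i x" for i
        unfolding f_def by (rule pderiv_i_mult[OF Ck_on_1D(1)[OF W x(1)] Ck_on_1D(1)[OF cf x(1)]])
      then show ?thesis
        by (simp add: I_def sum.distrib sum_distrib_left[symmetric] div_chr_field[OF x(2)] mult_ac)
    next
      case False
      then show ?thesis using p0 K(3) by (simp add: I_def)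
    qed
  qed
  show "integrable lborel I" unfolding I using int by simp
  have "integral\<^sup>L lborel I = (\<Sum>i\<in>UNIV. integral\<^sup>L lborel (pderiv_i (f i) i))"
    unfolding I using int by (intro Bochner_Integration.integral_sum) auto
  also have "\<dots> = 0"
    using integral_pderiv_eq_0[OF fU K(1)] f0 by simp
  finally show "integral\<^sup>L lborel I = 0" .
qed

text \<open>The previous lemma with \<open>W = w * H (r x)\<close>; by \<open>radial_pairing\<close>
  the derivative of \<open>H\<close> contributes only a multiple of \<open>sinh r\<close>. The
  support of \<open>w\<close> avoids the pole, so \<open>H\<close> may blow up at 0.\<close>

lemma radial_integration_by_parts:
  assumes w: "Ck_on (Suc 0) \<Omega> w" and K: "compact K" "K \<subseteq> \<Omega>" "\<And>x. x \<notin> K \<Longrightarrow> w x = 0"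
    and H: "\<And>t. t > 0 \<Longrightarrow> (H has_real_derivative H' t) (at t)" "continuous_on {0<..} H'"
  defines "I \<equiv> \<lambda>x. H (r x) * (\<Sum>i\<in>UNIV. pderiv_i w i x * chr_field i x)
      + w x * hdens x * (H' (r x) * sinh (r x) + real CARD('n) * H (r x) * cosh (r x))"
  shows "integrable lborel I" "integral\<^sup>L lborel I = 0"
proof -
  define W where "W x = w x * H (r x)" for x
  have "Ck_real (Suc 0) {0<..} H" using H by auto
  then have HO: "Ck_on (Suc 0) \<Omega> (\<lambda>x. H (r x))"
    by (rule Ck_on_compose[OF open_Omega, rotated]) (use r_pos Ck_on_r[of "Suc 0"] in auto)
  have WO: "Ck_on (Suc 0) \<Omega> W" unfolding W_def by (rule Ck_on_mult[OF open_Omega w HO])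
  have W0: "W x = 0" if "x \<notin> K" for x using K(3)[OF that] by (simp add: W_def)
  have eq: "I = (\<lambda>x. (\<Sum>i\<in>UNIV. pderiv_i W i x * chr_field i x) + real CARD('n) * (W x * hdens x * chr x))"
  proof
    fix x
    show "I x = (\<Sum>i\<in>UNIV. pderiv_i W i x * chr_field i x) + real CARD('n) * (W x * hdens x * chr x)"
    proof (cases "x \<in> K")
      case True
      then have x: "x \<in> \<Omega>" "x \<in> hball" using K(2) Omega_subset by auto
      have "pderiv_i W i x = w x * (H' (r x) * pderiv_i r i x) + pderiv_i w i x * H (r x)" for i
        unfolding W_def using pderiv_i_mult[OF Ck_on_1D(1)[OF w x(1)] Ck_on_1D(1)[OF HO x(1)]]
          pderiv_i_compose[where f=r, OF H(1)[OF r_pos[OF x(1)]] r_differentiable[OF x(1)]] by simp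
      then have "(\<Sum>i\<in>UNIV. pderiv_i W i x * chr_field i x)
          = (\<Sum>i\<in>UNIV. w x * H' (r x) * (pderiv_i r i x * chr_field i x) + H (r x) * (pderiv_i w i x * chr_field i x))"
        by (intro sum.cong) (auto simp: algebra_simps)
      also have "\<dots> = w x * H' (r x) * (hdens x * sinh (r x)) + H (r x) * (\<Sum>i\<in>UNIV. pderiv_i w i x * chr_field i x)"
        by (simp only: sum.distrib sum_distrib_left[symmetric] radial_pairing[OF x(1)])
      finally show ?thesis
        by (simp add: I_def W_def cosh_r[OF x(2)] algebra_simps)
    next
      case False
      have "pderiv_i w i x = 0" "pderiv_i W i x = 0" for i
        using pderiv_i_eq_0_outside[OF compact_imp_closed[OF K(1)]] W0 K(3) False by blast+
      then show ?thesis using W0[OF False] K(3)[OF False] by (simp add: I_def)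
    qed
  qed
  show "integrable lborel I" "integral\<^sup>L lborel I = 0"
    unfolding eq by (rule integral_div_chr_field[OF WO K(1,2) W0], assumption)+
qed

text \<open>With \<open>H = g / sinh\<close> the field \<open>H (r x) * chr_field\<close> is
  \<open>hdens * g\<close> times the hyperbolic gradient of \<open>r\<close>, and the Riccati
  equation turns its divergence into \<open>- hdens * (V + g^2)\<close>.\<close>

lemma ground_integration_by_parts:
  assumes w: "Ck_on (Suc 0) \<Omega> w" and K: "compact K" "K \<subseteq> \<Omega>" "\<And>x. x \<notin> K \<Longrightarrow> w x = 0"
  defines "g \<equiv> ground_logder (real CARD('n))"
  defines "I \<equiv> \<lambda>x. g (r x) / sinh (r x) * (\<Sum>i\<in>UNIV. pderiv_i w i x * chr_field i x)
      - w x * hdens x * (hardy_pot (real CARD('n)) (r x) + (g (r x))\<^sup>2)"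
  shows "integrable lborel I" "integral\<^sup>L lborel I = 0"
proof -
  define d where "d = real CARD('n)"
  define g' where "g' t = - 1 / (2 * t\<^sup>2) + (d - 1) / 2 / (sinh t)\<^sup>2" for t
  define H where "H t = g t / sinh t" for t
  define H' where "H' t = (g' t * sinh t - g t * cosh t) / (sinh t)\<^sup>2" for t
  have H: "(H has_real_derivative H' t) (at t)" if "t > 0" for t
    using ground_logder_has_derivative[OF that, of d] that unfolding H_def H'_def g'_def g_def d_def
    by (auto intro!: derivative_eq_intros simp: power2_eq_square)
  have H'c: "continuous_on {0<..} H'"
    unfolding H'_def g'_def using continuous_on_ground_logder[of d]
    by (auto intro!: continuous_intros simp: g_def d_def)
  have "I = (\<lambda>x. H (r x) * (\<Sum>i\<in>UNIV. pderiv_i w i x * chr_field i x)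
      + w x * hdens x * (H' (r x) * sinh (r x) + real CARD('n) * H (r x) * cosh (r x)))"
  proof
    fix x
    show "I x = H (r x) * (\<Sum>i\<in>UNIV. pderiv_i w i x * chr_field i x)
      + w x * hdens x * (H' (r x) * sinh (r x) + real CARD('n) * H (r x) * cosh (r x))"
    proof (cases "x \<in> K")
      case True
      then have x: "x \<in> \<Omega>" using K(2) by auto
      have "H' (r x) * sinh (r x) + d * H (r x) * cosh (r x)
          = g' (r x) + (d - 1) * (cosh (r x) / sinh (r x)) * g (r x)"
        using sinh_r_pos[OF x] by (simp add: H_def H'_def field_simps power2_eq_square)
      also have "\<dots> = - (hardy_pot d (r x) + (g (r x))\<^sup>2)"
        using ground_logder_riccati[OF r_pos[OF x], of d] by (simp add: g'_def g_def d_def)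
      finally have "H' (r x) * sinh (r x) + real CARD('n) * H (r x) * cosh (r x)
          = - (hardy_pot (real CARD('n)) (r x) + (g (r x))\<^sup>2)" by (simp add: d_def)
      then show ?thesis by (simp only: I_def H_def)
    next
      case False
      have "pderiv_i w i x = 0" for i
        using pderiv_i_eq_0_outside[OF compact_imp_closed[OF K(1)]] K(3) False by blast
      then show ?thesis using K(3)[OF False] by (simp add: I_def)
    qed
  qed
  then show "integrable lborel I" "integral\<^sup>L lborel I = 0"
    using radial_integration_by_parts[OF w K H H'c] by auto
qed

section \<open>Level sets of the distance and compact annuli\<close>

lemma le_r_iff:
  assumes "x \<in> hball" "0 \<le> a"
  shows "a \<le> r x \<longleftrightarrow> (cosh a - 1) * (defect x * defect x0) \<le> 2 * esq x"
proof -
  have "a \<le> r x \<longleftrightarrow> cosh a \<le> chr x"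
    using cosh_real_nonneg_le_iff[OF assms(2) r_nonneg[OF assms(1)]] cosh_r[OF assms(1)] by simp
  then show ?thesis
    using defect_pos[OF assms(1)] defect_pole_pos by (simp add: chr_def field_simps)
qed

lemma r_le_iff:
  assumes "x \<in> hball" "0 \<le> b"
  shows "r x \<le> b \<longleftrightarrow> 2 * esq x \<le> (cosh b - 1) * (defect x * defect x0)"
proof -
  have "r x \<le> b \<longleftrightarrow> chr x \<le> cosh b"
    using cosh_real_nonneg_le_iff[OF r_nonneg[OF assms(1)] assms(2)] cosh_r[OF assms(1)] by simp
  then show ?thesis
    using defect_pos[OF assms(1)] defect_pole_pos by (simp add: chr_def field_simps)
qed

lemma continuous_on_defect_esq: "continuous_on S defect" "continuous_on S esq"
  unfolding defect_def esq_def by (auto intro!: continuous_intros)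

lemma r_pole: "r x0 = 0"
  by (simp add: r_eq_arcosh chr_def esq_def)

lemma compact_ge_r:
  assumes "compact L" "L \<subseteq> hball" "0 < a"
  shows "compact {x\<in>L. a \<le> r x}" "{x\<in>L. a \<le> r x} \<subseteq> \<Omega>"
proof -
  have "{x\<in>L. a \<le> r x} = L \<inter> {x. (cosh a - 1) * (defect x * defect x0) \<le> 2 * esq x}"
    using assms le_r_iff by auto
  moreover have "closed {x. (cosh a - 1) * (defect x * defect x0) \<le> 2 * esq x}"
    by (intro closed_Collect_le continuous_intros continuous_on_defect_esq)
  ultimately show "compact {x\<in>L. a \<le> r x}" using assms(1) by (simp add: compact_Int_closed)
  show "{x\<in>L. a \<le> r x} \<subseteq> \<Omega>" using assms r_pole by (auto simp: \<Omega>_def)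
qed

lemma compact_annulus:
  assumes "0 < a" "0 \<le> b"
  shows "compact {x\<in>hball. a \<le> r x \<and> r x \<le> b}" "{x\<in>hball. a \<le> r x \<and> r x \<le> b} \<subseteq> \<Omega>"
proof -
  \<comment> \<open>With denominators cleared, the condition \<open>r x \<le> b\<close> makes sense
    on the closed Euclidean ball and is closed there. It adds no boundary point: there
    \<open>defect\<close> vanishes, which forces \<open>x = x0\<close>.\<close>
  have hb: "x \<in> hball" if "norm x \<le> 1" "2 * esq x \<le> (cosh b - 1) * (defect x * defect x0)" for x
  proof (rule ccontr)
    assume "x \<notin> hball"
    then have n: "norm x = 1" using that(1) by (simp add: hball_def)
    then have "defect x = 0" by (simp add: defect_def)
    then have "x = x0" using that(2) by (simp add: esq_def)
    then show False using n pole_in_hball by (simp add: hball_def)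
  qed
  have "{x\<in>hball. r x \<le> b} = cball 0 1 \<inter> {x. 2 * esq x \<le> (cosh b - 1) * (defect x * defect x0)}"
    using hb r_le_iff[OF _ assms(2)] by (auto simp: hball_def)
  moreover have "closed {x. 2 * esq x \<le> (cosh b - 1) * (defect x * defect x0)}"
    by (intro closed_Collect_le continuous_intros continuous_on_defect_esq)
  ultimately have "compact {x\<in>hball. r x \<le> b}" by (simp add: compact_Int_closed)
  from compact_ge_r[OF this _ assms(1)]
  have "compact {x\<in>{x\<in>hball. r x \<le> b}. a \<le> r x}" "{x\<in>{x\<in>hball. r x \<le> b}. a \<le> r x} \<subseteq> \<Omega>"
    by auto
  moreover have "{x\<in>{x\<in>hball. r x \<le> b}. a \<le> r x} = {x\<in>hball. a \<le> r x \<and> r x \<le> b}" by auto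
  ultimately show "compact {x\<in>hball. a \<le> r x \<and> r x \<le> b}" "{x\<in>hball. a \<le> r x \<and> r x \<le> b} \<subseteq> \<Omega>"
    by simp_all
qed

end

subsection \<open>The Hardy inequality\<close>

lemma test_funsE:
  assumes "u \<in> test_funs U"
  obtains L where "compact L" "L \<subseteq> U" "\<And>x. x \<notin> L \<Longrightarrow> u x = 0" "\<And>k. Ck_on k UNIV u"
    "\<And>x i. x \<notin> L \<Longrightarrow> pderiv_i u i x = 0"
proof
  show "compact (closure {x. u x \<noteq> 0})" "closure {x. u x \<noteq> 0} \<subseteq> U" "\<And>k. Ck_on k UNIV u"
    using assms by (auto simp: test_funs_def smooth_fun_def Ck_eq_Ck_on_UNIV)
  show z: "u x = 0" if "x \<notin> closure {x. u x \<noteq> 0}" for x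
    using that closure_subset[of "{x. u x \<noteq> 0}"] by auto
  show "pderiv_i u i x = 0" if "x \<notin> closure {x. u x \<noteq> 0}" for x i
    by (rule pderiv_i_eq_0_outside[OF closed_closure z that])
qed

context hyperbolic_pole
begin

lemma r_measurable: "r \<in> borel_measurable borel"
  unfolding r_def[abs_def] hdist_def arcosh_def by measurable

lemma hdens_measurable: "(hdens :: real^'n \<Rightarrow> real) \<in> borel_measurable borel"
  unfolding hdens_def[abs_def] by measurable

lemma hgrad_sq_eq: "hgrad_sq u x = (defect x / 2)\<^sup>2 * (\<Sum>i\<in>UNIV. (pderiv_i u i x)\<^sup>2)"
  by (simp add: hgrad_sq_def defect_def)

lemma hgrad_sq_nonneg: "0 \<le> hgrad_sq u x"
  by (simp add: hgrad_sq_def sum_nonneg)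

lemma integrable_hgrad_sq:
  assumes "u \<in> test_funs (hball :: (real^'n) set)"
  shows "integrable lborel (\<lambda>x. hgrad_sq u x * hdens x)"
proof -
  obtain L where L: "compact L" "L \<subseteq> hball" "\<And>k. Ck_on k UNIV u" "\<And>x i. x \<notin> L \<Longrightarrow> pderiv_i u i x = 0"
    using test_funsE[OF assms] by metis
  have "continuous_on L (pderiv_i u i)" for i
    using Ck_on_1D(2)[OF L(3), of i] by (rule continuous_on_subset) simp
  moreover have "continuous_on L (hdens :: real^'n \<Rightarrow> real)"
    using continuous_on_hdens L(2) by (rule continuous_on_subset)
  ultimately have "continuous_on L (\<lambda>x. hgrad_sq u x * hdens x)"
    unfolding hgrad_sq_eq by (intro continuous_intros continuous_on_defect_esq) auto
  then show ?thesis
    by (rule integrable_compact_support[OF L(1)]) (simp add: hgrad_sq_def L(4))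
qed

lemma pointwise_square:
  assumes x: "x \<in> \<Omega>"
  shows "2 * u x * g * (\<Sum>i\<in>UNIV. pderiv_i u i x * chr_field i x) / sinh (r x)
    \<le> (hgrad_sq u x + (u x)\<^sup>2 * g\<^sup>2) * hdens x"
proof -
  define b where "b = (defect x / 2)\<^sup>2"
  define P where "P = (\<Sum>i\<in>UNIV. pderiv_i u i x * pderiv_i r i x)"
  have s: "sinh (r x) > 0" using sinh_r_pos[OF x] .
  have hd: "hdens x > 0" using hdens_pos x Omega_subset by auto
  have "(\<Sum>i\<in>UNIV. pderiv_i u i x * chr_field i x)
      = (\<Sum>i\<in>UNIV. hdens x * b * sinh (r x) * (pderiv_i u i x * pderiv_i r i x))"
    by (intro sum.cong) (auto simp: chr_field_eq_r[OF x] b_def)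
  then have G: "(\<Sum>i\<in>UNIV. pderiv_i u i x * chr_field i x) = hdens x * b * sinh (r x) * P"
    by (simp add: P_def sum_distrib_left)
  have "0 \<le> b * (\<Sum>i\<in>UNIV. (pderiv_i u i x - u x * g * pderiv_i r i x)\<^sup>2)"
    by (simp add: b_def sum_nonneg)
  also have "(\<Sum>i\<in>UNIV. (pderiv_i u i x - u x * g * pderiv_i r i x)\<^sup>2)
      = (\<Sum>i\<in>UNIV. (pderiv_i u i x)\<^sup>2 - 2 * u x * g * (pderiv_i u i x * pderiv_i r i x) + (u x * g)\<^sup>2 * (pderiv_i r i x)\<^sup>2)"
    by (intro sum.cong) (auto simp: power2_eq_square algebra_simps)
  also have "\<dots> = (\<Sum>i\<in>UNIV. (pderiv_i u i x)\<^sup>2) - 2 * u x * g * P + (u x * g)\<^sup>2 * (\<Sum>i\<in>UNIV. (pderiv_i r i x)\<^sup>2)"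
    by (simp add: sum.distrib sum_subtractf sum_distrib_left P_def)
  also have "b * \<dots> = hgrad_sq u x - 2 * u x * g * b * P + (u x * g)\<^sup>2 * (b * (\<Sum>i\<in>UNIV. (pderiv_i r i x)\<^sup>2))"
    by (simp add: hgrad_sq_eq b_def algebra_simps)
  also have "b * (\<Sum>i\<in>UNIV. (pderiv_i r i x)\<^sup>2) = 1"
    using eikonal[OF x] by (simp add: b_def)
  finally have "2 * u x * g * b * P \<le> hgrad_sq u x + (u x)\<^sup>2 * g\<^sup>2"
    by (simp add: power_mult_distrib)
  then have "2 * u x * g * b * P * hdens x \<le> (hgrad_sq u x + (u x)\<^sup>2 * g\<^sup>2) * hdens x"
    using hd by simp
  then show ?thesis using s by (simp add: G mult_ac)
qed

text \<open>Cutting off at the pole only helps: the cutoff increases along \<open>r\<close> while the logarithmic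
  derivative of the ground state is nonpositive.\<close>

lemma hardy_cutoff:
  assumes u: "u \<in> test_funs hball" and c: "c > 0"
  defines "\<theta> \<equiv> \<lambda>x. flat_exp 0 (c * r x - 1)"
  defines "F \<equiv> \<lambda>x. \<theta> x * (hardy_pot (real CARD('n)) (r x) * (u x)\<^sup>2 * hdens x)"
  shows "integrable lborel F" "integral\<^sup>L lborel F \<le> hint (hgrad_sq u)"
proof -
  obtain L where L: "compact L" "L \<subseteq> hball" "\<And>x. x \<notin> L \<Longrightarrow> u x = 0" "\<And>k. Ck_on k UNIV u"
    "\<And>x i. x \<notin> L \<Longrightarrow> pderiv_i u i x = 0"
    using test_funsE[OF u] by metis
  \<comment> \<open>The cutoff vanishes for \<open>c * r x \<le> 1\<close>, so \<open>w\<close> is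
    supported in this compact set off the pole and integration by parts applies.\<close>
  define K where "K = {x\<in>L. 1 / c \<le> r x}"
  have K: "compact K" "K \<subseteq> \<Omega>"
    using compact_ge_r[OF L(1,2), of "1 / c"] c by (auto simp: K_def)
  define d where "d = real CARD('n)"
  define g where "g = ground_logder d"
  define w where "w x = (u x)\<^sup>2 * \<theta> x" for x
  have u0: "Ck_on (Suc 0) \<Omega> u" using Ck_on_mono[OF L(4)] by blast
  have t0: "Ck_on (Suc 0) \<Omega> \<theta>"
    unfolding \<theta>_def
    by (rule Ck_on_compose[OF open_Omega, where I=UNIV and h="flat_exp 0"])
      (auto intro!: Ck_real_flat_exp Ck_on_diff Ck_on_mult Ck_on_const Ck_on_r open_Omega simp del: Ck_on.simps Ck_real.simps)
  have w0: "Ck_on (Suc 0) \<Omega> w"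
    unfolding w_def by (intro Ck_on_mult Ck_on_power open_Omega u0 t0)
  have wK: "w x = 0" if "x \<notin> K" for x
  proof (cases "x \<in> L")
    case True
    then have "c * r x - 1 \<le> 0" using that c by (auto simp: K_def field_simps)
    then show ?thesis by (simp add: w_def \<theta>_def flat_exp_eq_0)
  qed (simp add: w_def L(3))
  define I where "I x = g (r x) / sinh (r x) * (\<Sum>i\<in>UNIV. pderiv_i w i x * chr_field i x)
      - w x * hdens x * (hardy_pot d (r x) + (g (r x))\<^sup>2)" for x
  have I: "integrable lborel I" "integral\<^sup>L lborel I = 0"
    using ground_integration_by_parts[OF w0 K wK] unfolding I_def g_def d_def by auto
  have F: "F x = w x * (hardy_pot d (r x) * hdens x)" for x
    by (simp add: F_def w_def d_def)
  show Fi: "integrable lborel F"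
  proof (rule integrable_compact_support[OF K(1)])
    have "continuous_on \<Omega> F"
      unfolding F using Ck_on_imp_continuous_on[OF w0] continuous_on_r r_pos continuous_on_hardy_pot[of d]
        continuous_on_hdens Omega_subset
      by (intro continuous_intros continuous_on_compose2[OF continuous_on_hardy_pot[of d] continuous_on_r])
        (auto intro: continuous_on_subset)
    then show "continuous_on K F" using K(2) by (rule continuous_on_subset)
  qed (simp add: F wK)
  have le: "I x + F x \<le> hgrad_sq u x * hdens x" for x
  proof (cases "x \<in> K")
    case True
    then have x: "x \<in> \<Omega>" "x \<in> hball" using K(2) Omega_subset by auto
    have s: "sinh (r x) > 0" using sinh_r_pos[OF x(1)] .
    have hd: "hdens x > 0" using hdens_pos[OF x(2)] .
    \<comment> \<open>The radial derivative of the cutoff. For \<open>j = 0\<close> only the term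
      \<open>flat_exp 2\<close> survives in the derivative of \<open>flat_exp j\<close>, so it is
      visibly nonnegative.\<close>
    define \<tau>' where "\<tau>' = c * flat_exp 2 (c * r x - 1)"
    define G where "G = (\<Sum>i\<in>UNIV. pderiv_i u i x * chr_field i x)"
    have "((\<lambda>t. flat_exp 0 (c * t - 1)) has_real_derivative \<tau>') (at (r x))"
      unfolding \<tau>'_def
    proof -
      have "((\<lambda>t. c * t - 1) has_real_derivative c) (at (r x))"
        by (auto intro!: derivative_eq_intros)
      from DERIV_chain2[where f="flat_exp 0", OF flat_exp_has_derivative this]
      show "((\<lambda>t. flat_exp 0 (c * t - 1)) has_real_derivative c * flat_exp 2 (c * r x - 1)) (at (r x))"
        by (simp add: mult.commute[of _ c] numeral_2_eq_2)
    qed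
    from pderiv_i_compose[where f=r, OF this r_differentiable[OF x(1)]]
    have pt: "pderiv_i \<theta> i x = \<tau>' * pderiv_i r i x" for i by (simp add: \<theta>_def)
    have "pderiv_i w i x = u x * u x * pderiv_i \<theta> i x + (u x * pderiv_i u i x + pderiv_i u i x * u x) * \<theta> x" for i
      unfolding w_def power2_eq_square using Ck_on_1D(1)[OF u0 x(1)] Ck_on_1D(1)[OF t0 x(1)]
      by (simp add: pderiv_i_mult differentiable_mult)
    then have "(\<Sum>i\<in>UNIV. pderiv_i w i x * chr_field i x)
        = (\<Sum>i\<in>UNIV. (u x)\<^sup>2 * \<tau>' * (pderiv_i r i x * chr_field i x) + 2 * u x * \<theta> x * (pderiv_i u i x * chr_field i x))"
      by (intro sum.cong) (auto simp: pt power2_eq_square algebra_simps)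
    also have "\<dots> = (u x)\<^sup>2 * \<tau>' * (hdens x * sinh (r x)) + 2 * u x * \<theta> x * G"
      by (simp only: sum.distrib sum_distrib_left[symmetric] radial_pairing[OF x(1)] G_def)
    finally have "I x + F x = g (r x) * ((u x)\<^sup>2 * \<tau>' * hdens x)
        + \<theta> x * (2 * u x * g (r x) * G / sinh (r x) - (u x)\<^sup>2 * (g (r x))\<^sup>2 * hdens x)"
      using s by (simp add: I_def F w_def field_simps)
    also have "\<dots> \<le> 0 + \<theta> x * (hgrad_sq u x * hdens x)"
    proof (rule add_mono)
      have "g (r x) \<le> 0" "0 \<le> \<tau>'"
        using ground_logder_nonpos[OF r_pos[OF x(1)], of d] dim_ge_3 c
        by (auto simp: g_def d_def \<tau>'_def flat_exp_nonneg)
      then show "g (r x) * ((u x)\<^sup>2 * \<tau>' * hdens x) \<le> 0"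
        using hd by (intro mult_nonpos_nonneg) auto
      show "\<theta> x * (2 * u x * g (r x) * G / sinh (r x) - (u x)\<^sup>2 * (g (r x))\<^sup>2 * hdens x) \<le> \<theta> x * (hgrad_sq u x * hdens x)"
        using pointwise_square[OF x(1), of u "g (r x)"]
        by (intro mult_left_mono) (auto simp: G_def \<theta>_def flat_exp_nonneg algebra_simps)
    qed
    \<comment> \<open>Dropping the cutoff on the gradient side makes the bound independent of
      \<open>c\<close>, as the passage to the limit requires.\<close>
    also have "\<dots> \<le> 1 * (hgrad_sq u x * hdens x)"
      unfolding add_0 using hd
      by (intro mult_right_mono) (auto simp: \<theta>_def flat_exp_0_le_1 hgrad_sq_nonneg)
    finally show ?thesis by simp
  next
    case False
    have "pderiv_i w i x = 0" for i
      using pderiv_i_eq_0_outside[of K w x i] compact_imp_closed[OF K(1)] wK False by blast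
    then have "I x + F x = 0" using wK[OF False] by (simp add: I_def F)
    also have "0 \<le> hgrad_sq u x * hdens x"
    proof (cases "x \<in> L")
      case True
      then show ?thesis using L(2) hdens_pos[of x] hgrad_sq_nonneg[of u x] by auto
    qed (simp add: hgrad_sq_def L(5))
    finally show ?thesis .
  qed
  have "integral\<^sup>L lborel (\<lambda>x. I x + F x) \<le> hint (hgrad_sq u)"
    unfolding hint_def using I(1) Fi integrable_hgrad_sq[OF u] le by (intro integral_mono) auto
  then show "integral\<^sup>L lborel F \<le> hint (hgrad_sq u)"
    using I Fi by simp
qed

text \<open>Monotone convergence along \<open>c = 1, 2, ...\<close>: the cutoffs increase to 1
  everywhere except at the pole, a null set, and the uniform bound from \<open>hardy_cutoff\<close>
  yields integrability near the pole as well as the inequality.\<close>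

lemma hardy_inequality:
  assumes u: "u \<in> test_funs hball"
  defines "F \<equiv> \<lambda>x. hardy_pot (real CARD('n)) (r x) * (u x)\<^sup>2 * hdens x"
  shows "integrable lborel F" "integral\<^sup>L lborel F \<le> hint (hgrad_sq u)"
proof -
  obtain L where L: "compact L" "L \<subseteq> hball" "\<And>x. x \<notin> L \<Longrightarrow> u x = 0" "\<And>k. Ck_on k UNIV u"
    using test_funsE[OF u] by metis
  have F0: "0 \<le> F x" for x
  proof (cases "x \<in> hball")
    case True
    then show ?thesis using hdens_pos[OF True] hardy_pot_nonneg[of "real CARD('n)" "r x"] dim_ge_3
      by (simp add: F_def)
  next
    case False
    then have "u x = 0" using L(2,3) by blast
    then show ?thesis by (simp add: F_def)
  qed
  have Foff: "F x = 0" if "x \<notin> hball" for x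
  proof -
    have "u x = 0" using that L(2,3) by blast
    then show ?thesis by (simp add: F_def)
  qed
  define f where "f n x = flat_exp 0 (real (Suc n) * r x - 1) * F x" for n x
  have fi: "integrable lborel (f n)" "integral\<^sup>L lborel (f n) \<le> hint (hgrad_sq u)" for n
    using hardy_cutoff[OF u, of "real (Suc n)"] unfolding f_def[abs_def] F_def by simp_all
  have mono: "f m x \<le> f n x" if "m \<le> n" for m n x
  proof (cases "x \<in> hball")
    case True
    have "real (Suc m) * r x \<le> real (Suc n) * r x"
      using that r_nonneg[OF True] by (intro mult_right_mono) auto
    then show ?thesis unfolding f_def by (intro mult_right_mono flat_exp_0_mono F0) auto
  qed (simp add: f_def Foff)
  have inc: "incseq (\<lambda>n. integral\<^sup>L lborel (f n))"
    using fi mono by (auto simp: incseq_def intro!: integral_mono)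
  obtain l where l: "(\<lambda>n. integral\<^sup>L lborel (f n)) \<longlonglongrightarrow> l"
    using incseq_convergent[OF inc] fi(2) by blast
  have Fm: "F \<in> borel_measurable borel"
  proof -
    have "u \<in> borel_measurable borel"
      using Ck_on_imp_continuous_on[OF L(4)] by (simp add: borel_measurable_continuous_onI)
    then show ?thesis
      unfolding F_def hardy_pot_def sinh_def using r_measurable hdens_measurable by measurable
  qed
  have lim: "(\<lambda>n. f n x) \<longlonglongrightarrow> F x" if "x \<noteq> x0" for x
  proof (cases "x \<in> hball")
    case True
    then have rp: "r x > 0" using that r_pos by (auto simp: \<Omega>_def)
    have top: "filterlim (\<lambda>n. real (Suc n) * r x - 1) at_top sequentially"
    proof -
      have "filterlim (\<lambda>n. (r x - 1) + r x * real n) at_top sequentially"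
        by (intro filterlim_tendsto_add_at_top[OF tendsto_const] filterlim_tendsto_pos_mult_at_top[OF tendsto_const rp] filterlim_real_sequentially)
      then show ?thesis by (simp add: algebra_simps)
    qed
    have "(\<lambda>n. exp (- inverse (real (Suc n) * r x - 1))) \<longlonglongrightarrow> exp (- 0)"
      by (intro tendsto_exp tendsto_minus tendsto_inverse_0_at_top top)
    moreover have "\<forall>\<^sub>F n in sequentially. exp (- inverse (real (Suc n) * r x - 1)) = flat_exp 0 (real (Suc n) * r x - 1)"
      using eventually_compose_filterlim[OF eventually_gt_at_top[of 0] top]
      by eventually_elim (simp add: flat_exp_def)
    ultimately have "(\<lambda>n. flat_exp 0 (real (Suc n) * r x - 1)) \<longlonglongrightarrow> 1"
      by (auto elim: Lim_transform_eventually)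
    from tendsto_mult[OF this tendsto_const[of "F x"]] show ?thesis by (simp add: f_def)
  qed (simp add: f_def Foff)
  have A1: "AE x in lborel. (\<lambda>n. f n x) \<longlonglongrightarrow> F x"
    using AE_lborel_singleton[of x0] by eventually_elim (rule lim)
  have A2: "AE x in lborel. 0 \<le> f n x" for n
    by (rule AE_I2) (simp add: f_def flat_exp_nonneg F0)
  have A3: "AE x in lborel. mono (\<lambda>n. f n x)"
    by (rule AE_I2) (rule monoI, rule mono)
  have A4: "F \<in> borel_measurable lborel" using Fm by simp
  note * = integral_monotone_convergence_nonneg[OF fi(1) A3 A2 A1 l A4]
  show "integrable lborel F" by (rule *)
  show "integral\<^sup>L lborel F \<le> hint (hgrad_sq u)"
    unfolding * by (rule LIMSEQ_le_const2[OF l]) (use fi in auto)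
qed

text \<open>Splitting the integral needs integrability of the three parts. As
  \<open>N \<ge> 3\<close> all are nonnegative, hence each is dominated by the full potential, which
  \<open>hardy_inequality\<close> has shown to be integrable against \<open>u^2\<close>.\<close>

lemma hint_hardy_pot:
  assumes u: "u \<in> test_funs hball"
  defines "d \<equiv> real CARD('n)"
  shows "hint (\<lambda>x. hardy_pot d (r x) * (u x)\<^sup>2) = (d - 1)\<^sup>2 / 4 * hint (\<lambda>x. (u x)\<^sup>2)
    + (1 / 4 * hint (\<lambda>x. (u x)\<^sup>2 / (r x)\<^sup>2) + (d - 1) * (d - 3) / 4 * hint (\<lambda>x. (u x)\<^sup>2 / (sinh (r x))\<^sup>2))"
proof -
  obtain L where L: "compact L" "L \<subseteq> hball" "\<And>x. x \<notin> L \<Longrightarrow> u x = 0" "\<And>k. Ck_on k UNIV u"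
    using test_funsE[OF u] by metis
  define h where "h x = (u x)\<^sup>2 * hdens x" for x
  have h0: "0 \<le> h x" for x
    using hdens_pos[of x] L by (cases "x \<in> L") (auto simp: h_def)
  have hm: "h \<in> borel_measurable borel"
    unfolding h_def using borel_measurable_continuous_onI[OF Ck_on_imp_continuous_on[OF L(4)]] hdens_measurable
    by (intro borel_measurable_times borel_measurable_power)
  have d: "0 \<le> (d - 1) * (d - 3) / 4" using dim_ge_3 by (simp add: d_def)
  have F: "integrable lborel (\<lambda>x. hardy_pot d (r x) * h x)"
    using hardy_inequality(1)[OF u] by (simp add: d_def h_def mult.assoc)
  have dom: "integrable lborel (\<lambda>x. p x * h x)"
    if "p \<in> borel_measurable borel" "\<And>x. 0 \<le> p x" "\<And>x. p x \<le> hardy_pot d (r x)" for p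
  proof (rule Bochner_Integration.integrable_bound[OF F])
    show "(\<lambda>x. p x * h x) \<in> borel_measurable lborel"
      using that(1) hm by (simp add: borel_measurable_times)
    have "norm (p x * h x) \<le> norm (hardy_pot d (r x) * h x)" for x
    proof -
      have "0 \<le> p x * h x" "p x * h x \<le> hardy_pot d (r x) * h x"
        using that(2,3)[of x] h0[of x] by (auto intro: mult_right_mono)
      then show ?thesis by simp
    qed
    then show "AE x in lborel. norm (p x * h x) \<le> norm (hardy_pot d (r x) * h x)" by simp
  qed
  have 1: "integrable lborel (\<lambda>x. (d - 1)\<^sup>2 / 4 * h x)"
    by (rule dom) (use d in \<open>auto simp: hardy_pot_def\<close>)
  have 2: "integrable lborel (\<lambda>x. 1 / (4 * (r x)\<^sup>2) * h x)"
    by (rule dom) (use d r_measurable in \<open>auto simp: hardy_pot_def\<close>)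
  have 3: "integrable lborel (\<lambda>x. (d - 1) * (d - 3) / 4 / (sinh (r x))\<^sup>2 * h x)"
  proof (rule dom)
    show "(\<lambda>x. (d - 1) * (d - 3) / 4 / (sinh (r x))\<^sup>2) \<in> borel_measurable borel"
      unfolding sinh_def using r_measurable by measurable
  qed (use d in \<open>auto simp: hardy_pot_def\<close>)
  have "hint (\<lambda>x. hardy_pot d (r x) * (u x)\<^sup>2)
      = (\<integral>x. (d - 1)\<^sup>2 / 4 * h x + (1 / (4 * (r x)\<^sup>2) * h x + (d - 1) * (d - 3) / 4 / (sinh (r x))\<^sup>2 * h x) \<partial>lborel)"
    unfolding hint_def hardy_pot_def h_def by (simp add: algebra_simps)
  also have "\<dots> = (\<integral>x. (d - 1)\<^sup>2 / 4 * h x \<partial>lborel) + ((\<integral>x. 1 / (4 * (r x)\<^sup>2) * h x \<partial>lborel)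
      + (\<integral>x. (d - 1) * (d - 3) / 4 / (sinh (r x))\<^sup>2 * h x \<partial>lborel))"
    using 1 2 3 by (simp only: Bochner_Integration.integral_add Bochner_Integration.integrable_add)
  also have "(\<integral>x. (d - 1)\<^sup>2 / 4 * h x \<partial>lborel) = (d - 1)\<^sup>2 / 4 * hint (\<lambda>x. (u x)\<^sup>2)"
    unfolding hint_def h_def by (rule integral_mult_right_zero)
  also have "(\<integral>x. 1 / (4 * (r x)\<^sup>2) * h x \<partial>lborel) = 1 / 4 * hint (\<lambda>x. (u x)\<^sup>2 / (r x)\<^sup>2)"
    unfolding hint_def h_def integral_mult_right_zero[symmetric] by (simp add: field_simps)
  \<comment> \<open>The factor is taken out by a rule that needs no integrability. For
    \<open>N = 3\<close> it is 0, and then domination says nothing about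
    \<open>u^2 / (sinh r)^2\<close> itself.\<close>
  also have "(\<integral>x. (d - 1) * (d - 3) / 4 / (sinh (r x))\<^sup>2 * h x \<partial>lborel)
      = (d - 1) * (d - 3) / 4 * hint (\<lambda>x. (u x)\<^sup>2 / (sinh (r x))\<^sup>2)"
    unfolding hint_def h_def integral_mult_right_zero[symmetric]
    by (intro Bochner_Integration.integral_cong) auto
  finally show ?thesis .
qed

end

subsection \<open>Trial functions\<close>

definition bump :: "real \<Rightarrow> real" where
  "bump s = flat_exp 0 (1 - s\<^sup>2)"

definition dbump :: "real \<Rightarrow> real" where
  "dbump s = - 2 * s * flat_exp 2 (1 - s\<^sup>2)"

lemma bump_has_derivative: "(bump has_real_derivative dbump s) (at s)"
proof -
  have "((\<lambda>s::real. 1 - s\<^sup>2) has_real_derivative - 2 * s) (at s)"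
    by (auto intro!: derivative_eq_intros)
  from DERIV_chain2[where f="flat_exp 0", OF flat_exp_has_derivative this]
  show ?thesis by (simp add: bump_def[abs_def] dbump_def mult.commute numeral_2_eq_2)
qed

lemma continuous_on_bump: "continuous_on S bump" "continuous_on S dbump"
proof -
  show "continuous_on S bump"
    using bump_has_derivative by (intro continuous_at_imp_continuous_on) (auto intro: DERIV_isCont)
  have "continuous_on UNIV (flat_exp 2)"
    using Ck_real_flat_exp[of 0 UNIV 2] by simp
  then have "continuous_on S (\<lambda>s. flat_exp 2 (1 - s\<^sup>2))"
    by (rule continuous_on_compose2) (auto intro!: continuous_intros)
  then show "continuous_on S dbump"
    unfolding dbump_def by (intro continuous_intros)
qed

lemma bump_eq_0: "1 \<le> \<bar>s\<bar> \<Longrightarrow> bump s = 0" "1 \<le> \<bar>s\<bar> \<Longrightarrow> dbump s = 0"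
  using abs_le_square_iff[of 1 s] by (auto simp: bump_def dbump_def flat_exp_eq_0)

lemma bump_pos: "\<bar>s\<bar> < 1 \<Longrightarrow> 0 < bump s"
  by (auto simp: bump_def abs_square_less_1 intro!: flat_exp_pos)

lemma bump_antimono: "\<bar>s\<bar> \<le> \<bar>t\<bar> \<Longrightarrow> bump t \<le> bump s"
  by (auto simp: bump_def abs_le_square_iff intro!: flat_exp_0_mono)

lemma bump_nonneg: "0 \<le> bump s"
  by (simp add: bump_def flat_exp_nonneg)

text \<open>In general \<open>B (-1)\<close> and \<open>B 1\<close> differ, so \<open>B\<close> has
  no compact support; but the tails are constant, and the difference of two rescalings with equal
  tail values does have compact support.\<close>

lemma compact_support_antiderivative:
  fixes \<beta> :: "real \<Rightarrow> real"
  assumes "continuous_on UNIV \<beta>" "\<And>s. 1 \<le> \<bar>s\<bar> \<Longrightarrow> \<beta> s = 0"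
  obtains B where "\<And>s. (B has_real_derivative \<beta> s) (at s)"
    "\<And>s. s \<le> -1 \<Longrightarrow> B s = B (-1)" "\<And>s. 1 \<le> s \<Longrightarrow> B s = B 1"
proof -
  have "\<exists>B. \<forall>x::real. - \<infinity> < ereal x \<longrightarrow> ereal x < \<infinity> \<longrightarrow> (B has_vector_derivative \<beta> x) (at x)"
    by (rule einterval_antiderivative) (use assms(1) in \<open>auto simp: continuous_on_eq_continuous_at\<close>)
  then obtain B where B: "(B has_real_derivative \<beta> s) (at s)" for s
    by (auto simp: has_real_derivative_iff_has_vector_derivative)
  have "B s = B (-1)" if "s \<le> -1" for s
  proof (cases "s = -1")
    case False
    then have lt: "s < -1" using that by simp
    obtain z where "s < z" "z < -1" "B (-1) - B s = (-1 - s) * \<beta> z"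
      using MVT2[OF lt, of B \<beta>] B by auto
    then show ?thesis using assms(2)[of z] by simp
  qed simp
  moreover have "B s = B 1" if "1 \<le> s" for s
  proof (cases "s = 1")
    case False
    then have lt: "1 < s" using that by simp
    obtain z where "1 < z" "z < s" "B s - B 1 = (s - 1) * \<beta> z"
      using MVT2[OF lt, of B \<beta>] B by auto
    then show ?thesis using assms(2)[of z] by simp
  qed simp
  ultimately show ?thesis using that B by blast
qed

text \<open>The powers are written with \<open>exp\<close> and \<open>ln\<close> so that the
  composition lemmas apply directly.\<close>

definition ground :: "real \<Rightarrow> real \<Rightarrow> real" where
  "ground d t = exp (1 / 2 * ln t - (d - 1) / 2 * ln (sinh t))"

lemma ground_has_derivative:
  "t > 0 \<Longrightarrow> (ground d has_real_derivative ground_logder d t * ground d t) (at t)"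
  unfolding ground_def[abs_def] ground_logder_def
  by (auto intro!: derivative_eq_intros simp: field_simps)

lemma ground_pos: "0 < ground d t"
  by (simp add: ground_def)

text \<open>The denominator is the radial factor of the volume element in dimension
  \<open>m\<close>; multiplying by it leaves only \<open>t\<close>.\<close>

lemma ground_sq:
  assumes "t > 0" "0 < m"
  shows "(ground (real m) t)\<^sup>2 = t / sinh t ^ (m - 1)"
proof -
  have "(ground (real m) t)\<^sup>2 = exp (ln t - real (m - 1) * ln (sinh t))"
    using assms(2) by (simp add: ground_def exp_double[symmetric] of_nat_diff field_simps)
  also have "\<dots> = t / sinh t ^ (m - 1)"
    using assms(1) by (simp add: exp_diff exp_of_nat_mult)
  finally show ?thesis .
qed

context hyperbolic_pole
begin

section \<open>Radial densities on a logarithmic scale\<close>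

definition log_annulus :: "real \<Rightarrow> real \<Rightarrow> (real^'n) set" where
  "log_annulus T k = {x\<in>hball. exp (T - k) \<le> r x \<and> r x \<le> exp (T + k)}"

lemma log_annulus: "compact (log_annulus T k)" "log_annulus T k \<subseteq> \<Omega>"
  unfolding log_annulus_def by (rule compact_annulus; simp)+

lemma outside_log_annulus:
  assumes "x \<in> \<Omega>" "x \<notin> log_annulus T k" "0 < k"
  shows "1 \<le> \<bar>(ln (r x) - T) / k\<bar>"
proof -
  have "r x < exp (T - k) \<or> exp (T + k) < r x"
    using assms(1,2) Omega_subset by (auto simp: log_annulus_def)
  then have "ln (r x) < T - k \<or> T + k < ln (r x)"
    using r_pos[OF assms(1)] by (metis exp_less_cancel_iff exp_ln)
  then show ?thesis using assms(3) by (auto simp: abs_if field_simps)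
qed

text \<open>The power of \<open>sinh r\<close> cancels the radial factor of the volume element and
  \<open>1 / r\<close> turns \<open>dr\<close> into \<open>ds\<close> for \<open>s = ln r\<close>,
  so in polar coordinates this is the density of \<beta>, centred at \<open>T\<close> and stretched
  by \<open>k\<close>, with respect to \<open>ds\<close>.\<close>

definition log_density :: "(real \<Rightarrow> real) \<Rightarrow> real \<Rightarrow> real \<Rightarrow> real^'n \<Rightarrow> real" where
  "log_density \<beta> T k x =
    (if x \<in> \<Omega> then \<beta> ((ln (r x) - T) / k) / (r x * sinh (r x) ^ (CARD('n) - 1)) else 0)"

lemma log_density_outside:
  assumes "\<And>s. 1 \<le> \<bar>s\<bar> \<Longrightarrow> \<beta> s = 0" "x \<notin> log_annulus T k" "0 < k"
  shows "log_density \<beta> T k x = 0"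
  using outside_log_annulus[OF _ assms(2,3)] assms(1) by (simp add: log_density_def)

lemma integrable_log_density:
  assumes "continuous_on UNIV \<beta>" "\<And>s. 1 \<le> \<bar>s\<bar> \<Longrightarrow> \<beta> s = 0" "0 < k"
  shows "integrable lborel (\<lambda>x. log_density \<beta> T k x * hdens x)"
proof (rule integrable_compact_support[OF log_annulus(1)[of T k]])
  have "continuous_on \<Omega> (\<lambda>x. \<beta> ((ln (r x) - T) / k) / (r x * sinh (r x) ^ (CARD('n) - 1)))"
    using r_pos sinh_r_pos assms(3)
    by (intro continuous_intros continuous_on_r continuous_on_compose2[OF assms(1)]) fastforce+
  then have "continuous_on \<Omega> (log_density \<beta> T k)"
    by (rule continuous_on_eq) (simp add: log_density_def)
  moreover have "continuous_on \<Omega> (hdens :: real^'n \<Rightarrow> real)"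
    using continuous_on_hdens Omega_subset by (rule continuous_on_subset)
  ultimately have "continuous_on \<Omega> (\<lambda>x. log_density \<beta> T k x * hdens x)" by (rule continuous_on_mult)
  then show "continuous_on (log_annulus T k) (\<lambda>x. log_density \<beta> T k x * hdens x)"
    using log_annulus(2) by (rule continuous_on_subset)
qed (use log_density_outside[OF assms(2) _ assms(3)] in auto)

text \<open>In polar coordinates both sides are \<open>k\<close> times the integral of \<open>\<beta>\<close> times the area of the unit
  sphere; here polar coordinates are replaced by the fact that the field
  \<open>\<nabla>r / sinh r ^ (N - 1)\<close> is divergence free.\<close>

lemma hint_log_density_scale:
  assumes \<beta>: "continuous_on UNIV \<beta>" "\<And>s. 1 \<le> \<bar>s\<bar> \<Longrightarrow> \<beta> s = 0" and k: "0 < k"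
  shows "hint (log_density \<beta> T k) = k * hint (log_density \<beta> 0 1)"
proof -
  define m where "m = CARD('n)"
  have m: "m = Suc (m - 1)" using dim_ge_3 by (simp add: m_def)
  obtain B where B: "\<And>s. (B has_real_derivative \<beta> s) (at s)"
    "\<And>s. s \<le> -1 \<Longrightarrow> B s = B (-1)" "\<And>s. 1 \<le> s \<Longrightarrow> B s = B 1"
    using compact_support_antiderivative[OF \<beta>] by metis
  \<comment> \<open>Both summands have constant tails \<open>k * B (-1)\<close> and
    \<open>k * B 1\<close>, so the difference vanishes outside a compact range of radii covering
    both annuli, and \<open>t * h' t\<close> is the difference of the two profiles to be
    compared.\<close>
  define h where "h t = k * B ((ln t - T) / k) - k * B (ln t)" for t
  define h' where "h' t = (\<beta> ((ln t - T) / k) - k * \<beta> (ln t)) / t" for t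
  have hd: "(h has_real_derivative h' t) (at t)" if "t > 0" for t
  proof -
    have "((\<lambda>t. B ((ln t - T) / k)) has_real_derivative \<beta> ((ln t - T) / k) * (1 / t / k)) (at t)"
      by (rule DERIV_chain2[OF B(1)]) (use that k in \<open>auto intro!: derivative_eq_intros\<close>)
    moreover have "((\<lambda>t. B (ln t)) has_real_derivative \<beta> (ln t) * (1 / t)) (at t)"
      by (rule DERIV_chain2[OF B(1)]) (use that in \<open>auto intro!: derivative_eq_intros\<close>)
    ultimately have "(h has_real_derivative (k * (\<beta> ((ln t - T) / k) * (1 / t / k)) - k * (\<beta> (ln t) * (1 / t)))) (at t)"
      unfolding h_def by (intro DERIV_diff DERIV_cmult)
    then show ?thesis using k by (simp add: h'_def diff_divide_distrib)
  qed
  have h'c: "continuous_on {0<..} h'"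
    unfolding h'_def using k
    by (intro continuous_intros continuous_on_compose2[OF \<beta>(1)]) auto
  define w where "w x = (if x \<in> \<Omega> then h (r x) else 0)" for x
  define a b where "a = min (-1) (T - k)" and "b = max 1 (T + k)"
  define K where "K = {x\<in>hball. exp a \<le> r x \<and> r x \<le> exp b}"
  have K: "compact K" "K \<subseteq> \<Omega>" unfolding K_def by (rule compact_annulus; simp)+
  have Kann: "log_annulus T k \<subseteq> K" "log_annulus 0 1 \<subseteq> K"
    by (auto simp: K_def log_annulus_def a_def b_def elim!: order_trans[rotated] intro: order_trans)
  have wK: "w x = 0" if "x \<notin> K" for x
  proof (cases "x \<in> \<Omega>")
    case True
    then have "r x < exp a \<or> exp b < r x" using that Omega_subset by (auto simp: K_def)
    then have "ln (r x) < a \<or> b < ln (r x)"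
      using r_pos[OF True] by (metis exp_less_cancel_iff exp_ln)
    then have "h (r x) = 0"
    proof
      assume "ln (r x) < a"
      then have "ln (r x) \<le> -1" "(ln (r x) - T) / k \<le> -1" using k by (auto simp: a_def field_simps)
      then show ?thesis using B(2)[of "ln (r x)"] B(2)[of "(ln (r x) - T) / k"] by (simp add: h_def)
    next
      assume "b < ln (r x)"
      then have "1 \<le> ln (r x)" "1 \<le> (ln (r x) - T) / k" using k by (auto simp: b_def field_simps)
      then show ?thesis using B(3)[of "ln (r x)"] B(3)[of "(ln (r x) - T) / k"] by (simp add: h_def)
    qed
    then show ?thesis by (simp add: w_def)
  qed (simp add: w_def)
  have "Ck_real (Suc 0) {0<..} h" using hd h'c by auto
  then have "Ck_on (Suc 0) \<Omega> (\<lambda>x. h (r x))"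
    by (rule Ck_on_compose[OF open_Omega, rotated]) (use r_pos Ck_on_r[of "Suc 0"] in auto)
  then have w0: "Ck_on (Suc 0) \<Omega> w"
    using Ck_on_cong[OF open_Omega, of w "\<lambda>x. h (r x)" "Suc 0"] by (simp add: w_def)
  \<comment> \<open>\<open>chr_field\<close> already contains one factor \<open>sinh r\<close>, so
    the exponent \<open>- N\<close> produces the field with \<open>sinh r ^ (N - 1)\<close> in the
    denominator; the zero-order term of the integration by parts then cancels.\<close>
  define H where "H t = inverse (sinh t) ^ m" for t :: real
  define H' where "H' t = - real m * cosh t * inverse (sinh t) ^ Suc m" for t :: real
  have Hd: "(H has_real_derivative H' t) (at t)" if "t > 0" for t
  proof -
    have "(H has_real_derivative real m * (- (inverse (sinh t) * cosh t * inverse (sinh t))) * inverse (sinh t) ^ (m - 1)) (at t)"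
      unfolding H_def using that by (auto intro!: derivative_eq_intros)
    moreover have "real m * (- (inverse (sinh t) * cosh t * inverse (sinh t))) * inverse (sinh t) ^ (m - 1) = H' t"
      unfolding H'_def by (subst (3) m) (simp add: mult_ac)
    ultimately show ?thesis by (simp only:)
  qed
  have H'c: "continuous_on {0<..} H'"
    unfolding H'_def by (auto intro!: continuous_intros)
  note ibp = radial_integration_by_parts[OF w0 K wK Hd H'c]
  have eq: "H (r x) * (\<Sum>i\<in>UNIV. pderiv_i w i x * chr_field i x)
      + w x * hdens x * (H' (r x) * sinh (r x) + real CARD('n) * H (r x) * cosh (r x))
      = log_density \<beta> T k x * hdens x - k * (log_density \<beta> 0 1 x * hdens x)" for x
  proof (cases "x \<in> K")
    case True
    then have x: "x \<in> \<Omega>" using K(2) by auto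
    have s: "sinh (r x) > 0" using sinh_r_pos[OF x] .
    have "pderiv_i w i x = h' (r x) * pderiv_i r i x" for i
      using pderiv_i_cong_open[OF open_Omega x, of w "\<lambda>x. h (r x)" i]
        pderiv_i_compose[where f=r, OF hd[OF r_pos[OF x]] r_differentiable[OF x]] by (simp add: w_def)
    then have S: "(\<Sum>i\<in>UNIV. pderiv_i w i x * chr_field i x) = h' (r x) * (hdens x * sinh (r x))"
      by (simp add: mult.assoc sum_distrib_left[symmetric] radial_pairing[OF x])
    have Z: "H' (r x) * sinh (r x) + real CARD('n) * H (r x) * cosh (r x) = 0"
      using s by (simp add: H_def H'_def m_def)
    have Q: "H (r x) * sinh (r x) = 1 / sinh (r x) ^ (m - 1)"
      unfolding H_def using s by (subst m) (simp add: field_simps)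
    have "H (r x) * (\<Sum>i\<in>UNIV. pderiv_i w i x * chr_field i x)
      + w x * hdens x * (H' (r x) * sinh (r x) + real CARD('n) * H (r x) * cosh (r x))
      = h' (r x) * (1 / sinh (r x) ^ (m - 1)) * hdens x"
      unfolding S Z Q[symmetric] by (simp only: mult_zero_right add_0_right mult_ac)
    also have "\<dots> = log_density \<beta> T k x * hdens x - k * (log_density \<beta> 0 1 x * hdens x)"
      using x s r_pos[OF x] by (simp add: log_density_def h'_def m_def field_simps)
    finally show ?thesis .
  next
    case False
    have "pderiv_i w i x = 0" for i
      using pderiv_i_eq_0_outside[of K w x i] compact_imp_closed[OF K(1)] wK False by blast
    moreover have "log_density \<beta> T k x = 0" "log_density \<beta> 0 1 x = 0"
      using log_density_outside[of \<beta>, OF \<beta>(2)] False Kann k by (meson subsetD zero_less_one)+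
    ultimately show ?thesis using wK[OF False] by simp
  qed
  have "(\<integral>x. log_density \<beta> T k x * hdens x - k * (log_density \<beta> 0 1 x * hdens x) \<partial>lborel) = 0"
    using ibp(2) unfolding eq .
  then show ?thesis
    using integrable_log_density[OF \<beta> k, of T] integrable_log_density[OF \<beta> zero_less_one, of 0]
    unfolding hint_def by simp
qed

section \<open>Truncated ground states and their energy\<close>

definition trial :: "real \<Rightarrow> real \<Rightarrow> real^'n \<Rightarrow> real" where
  "trial T k x = (if x \<in> \<Omega> then ground (real CARD('n)) (r x) * bump ((ln (r x) - T) / k) else 0)"

lemma trial_outside:
  assumes "x \<notin> log_annulus T k" "0 < k"
  shows "trial T k x = 0"
  using outside_log_annulus[OF _ assms] bump_eq_0 by (simp add: trial_def)

lemma Ck_on_trial: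
  assumes "0 < k"
  shows "Ck_on j UNIV (trial T k)"
proof (rule Ck_on_extend_by_zero[OF open_Omega])
  have ln: "Ck_on j \<Omega> (\<lambda>x. ln (f x))" if "Ck_on j \<Omega> f" "\<And>x. x \<in> \<Omega> \<Longrightarrow> 0 < f x" for f
    by (rule Ck_on_compose[OF open_Omega _ Ck_real_ln that(1)]) (use that(2) in auto)
  have sh: "Ck_on j \<Omega> (\<lambda>x. sinh (r x))"
    by (rule Ck_on_compose[OF open_Omega _ _ Ck_on_r, where I=UNIV]) (auto simp: Ck_real_sinh_cosh)
  have 1: "Ck_on j \<Omega> (\<lambda>x. exp (1 / 2 * ln (r x) - (real CARD('n) - 1) / 2 * ln (sinh (r x))))"
    by (rule Ck_on_compose[OF open_Omega _ Ck_real_exp[of j UNIV]], simp)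
      (intro Ck_on_diff Ck_on_mult Ck_on_const open_Omega ln Ck_on_r sh r_pos sinh_r_pos)
  have 2: "Ck_on j \<Omega> (\<lambda>x. flat_exp 0 (1 - ((ln (r x) - T) / k)\<^sup>2))"
  proof (rule Ck_on_compose[OF open_Omega _ Ck_real_flat_exp[of j UNIV 0]])
    show "Ck_on j \<Omega> (\<lambda>x. 1 - ((ln (r x) - T) / k)\<^sup>2)"
      unfolding divide_inverse by (intro Ck_on_diff Ck_on_power Ck_on_mult open_Omega ln[OF Ck_on_r r_pos] Ck_on_const)
  qed simp
  show "Ck_on j \<Omega> (trial T k)"
  proof (rule Ck_on_cong[OF open_Omega, THEN iffD2])
    show "trial T k x = exp (1 / 2 * ln (r x) - (real CARD('n) - 1) / 2 * ln (sinh (r x)))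
        * flat_exp 0 (1 - ((ln (r x) - T) / k)\<^sup>2)" if "x \<in> \<Omega>" for x
      using that by (simp add: trial_def ground_def bump_def)
    show "Ck_on j \<Omega> (\<lambda>x. exp (1 / 2 * ln (r x) - (real CARD('n) - 1) / 2 * ln (sinh (r x)))
        * flat_exp 0 (1 - ((ln (r x) - T) / k)\<^sup>2))"
      by (rule Ck_on_mult[OF open_Omega 1 2])
  qed
  show "closed (log_annulus T k)" "log_annulus T k \<subseteq> \<Omega>"
    using compact_imp_closed[OF log_annulus(1)] log_annulus(2) by blast+
qed (rule trial_outside[OF _ assms])

lemma trial_in_test_funs:
  assumes "0 < k" "log_annulus T k \<subseteq> U"
  shows "trial T k \<in> test_funs U"
proof -
  have "closure {x. trial T k x \<noteq> 0} \<subseteq> log_annulus T k"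
    using trial_outside[OF _ assms(1)] log_annulus(1) by (intro closure_minimal) (auto intro: compact_imp_closed)
  moreover from this have "compact (closure {x. trial T k x \<noteq> 0})"
    using log_annulus(1) by (meson closed_closure compact_closure compact_imp_bounded bounded_subset closure_subset)
  ultimately show ?thesis
    using assms Ck_on_trial by (auto simp: test_funs_def smooth_fun_def Ck_eq_Ck_on_UNIV)
qed

lemma trial_in_test_funs_Omega:
  assumes "0 < k"
  shows "trial T k \<in> test_funs \<Omega>" "trial T k \<in> test_funs hball"
  using trial_in_test_funs[OF assms] log_annulus(2) Omega_subset by blast+

lemma trial_sq:
  assumes "x \<in> \<Omega>"
  shows "(trial T k x)\<^sup>2 = (bump ((ln (r x) - T) / k))\<^sup>2 * (r x / sinh (r x) ^ (CARD('n) - 1))"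
  using assms ground_sq[OF r_pos[OF assms], of "CARD('n)"] dim_ge_3
  by (simp add: trial_def power_mult_distrib)

text \<open>Because \<open>\<phi>^2 / r^2 = 1 / (r * sinh r ^ (N - 1))\<close>, the Hardy term of a
  trial function is exactly the logarithmic density of \<open>bump^2\<close>.\<close>

lemma trial_sq_div_r_sq: "(trial T k x)\<^sup>2 / (r x)\<^sup>2 = log_density (\<lambda>s. (bump s)\<^sup>2) T k x"
proof (cases "x \<in> \<Omega>")
  case True
  then show ?thesis
    using r_pos[OF True] by (simp add: trial_sq[OF True] log_density_def power2_eq_square[of "r x"])
qed (simp add: trial_def log_density_def)

text \<open>The integral of \<open>dbump^2\<close> over the line times the area of the unit sphere,
  encoded as an integral over the ball so that neither factor has to be evaluated.\<close>

definition dbump_mass :: real where "dbump_mass = hint (log_density (\<lambda>s. (dbump s)\<^sup>2) 0 1)"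

definition bump_mass :: real where "bump_mass = hint (log_density (\<lambda>s. (bump s)\<^sup>2) 0 1)"

lemma hint_trial_sq_div_r_sq:
  assumes "0 < k"
  shows "hint (\<lambda>x. (trial T k x)\<^sup>2 / (r x)\<^sup>2) = k * bump_mass"
    "integrable lborel (\<lambda>x. (trial T k x)\<^sup>2 / (r x)\<^sup>2 * hdens x)"
proof -
  have c: "continuous_on UNIV (\<lambda>s. (bump s)\<^sup>2)" by (intro continuous_intros continuous_on_bump)
  show "hint (\<lambda>x. (trial T k x)\<^sup>2 / (r x)\<^sup>2) = k * bump_mass"
    unfolding trial_sq_div_r_sq bump_mass_def
    using hint_log_density_scale[OF c _ assms] bump_eq_0 by simp
  show "integrable lborel (\<lambda>x. (trial T k x)\<^sup>2 / (r x)\<^sup>2 * hdens x)"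
    unfolding trial_sq_div_r_sq using integrable_log_density[OF c _ assms] bump_eq_0 by simp
qed

text \<open>Along \<open>r\<close> the derivative of \<open>u\<close> is \<open>g * u + e\<close>,
  and integration by parts with weight \<open>u^2\<close> cancels everything but \<open>e^2\<close>.
  The chain rule contributes \<open>1 / k^2\<close> and the stretched support a factor
  \<open>k\<close>, hence \<open>1 / k\<close>.\<close>

lemma trial_energy:
  assumes k: "0 < k"
  shows "hint (hgrad_sq (trial T k)) - hint (\<lambda>x. hardy_pot (real CARD('n)) (r x) * (trial T k x)\<^sup>2)
    = dbump_mass / k"
proof -
  define d where "d = real CARD('n)"
  define u where "u = trial T k"
  define g where "g = ground_logder d"
  define K where "K = log_annulus T k"
  note K = log_annulus[of T k, folded K_def]
  have uT: "u \<in> test_funs hball" using trial_in_test_funs_Omega[OF k] by (simp add: u_def)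
  have u0: "Ck_on (Suc 0) \<Omega> u" unfolding u_def using Ck_on_mono[OF Ck_on_trial[OF k]] by blast
  have uK: "u x = 0" if "x \<notin> K" for x using trial_outside[OF _ k] that by (simp add: u_def K_def)
  define w where "w x = (u x)\<^sup>2" for x
  have w0: "Ck_on (Suc 0) \<Omega> w" unfolding w_def by (intro Ck_on_power open_Omega u0)
  have wK: "w x = 0" if "x \<notin> K" for x using uK[OF that] by (simp add: w_def)
  define I where "I x = g (r x) / sinh (r x) * (\<Sum>i\<in>UNIV. pderiv_i w i x * chr_field i x)
      - w x * hdens x * (hardy_pot d (r x) + (g (r x))\<^sup>2)" for x
  have I: "integrable lborel I" "integral\<^sup>L lborel I = 0"
    using ground_integration_by_parts[OF w0 K wK] unfolding I_def g_def d_def by auto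
  define j where "j x = log_density (\<lambda>s. (dbump s)\<^sup>2) T k x * hdens x" for x
  have cd: "continuous_on UNIV (\<lambda>s. (dbump s)\<^sup>2)" by (intro continuous_intros continuous_on_bump)
  have z: "(dbump s)\<^sup>2 = 0" if "1 \<le> \<bar>s\<bar>" for s using bump_eq_0(2)[OF that] by simp
  have jint: "integrable lborel j"
    unfolding j_def by (rule integrable_log_density[OF cd z k])
  have eq: "hgrad_sq u x * hdens x - hardy_pot d (r x) * (u x)\<^sup>2 * hdens x = I x + 1 / k\<^sup>2 * j x" for x
  proof (cases "x \<in> K")
    case True
    then have x: "x \<in> \<Omega>" using K(2) by auto
    define t where "t = r x"
    have t: "t > 0" "sinh t > 0" using r_pos[OF x] sinh_r_pos[OF x] by (auto simp: t_def)
    define f where "f t = ground d t * bump ((ln t - T) / k)" for t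
    \<comment> \<open>The part of the derivative that falls on the bump; \<open>1 / (k * t)\<close>
      is the derivative of \<open>(ln t - T) / k\<close>.\<close>
    define e where "e = ground d t * dbump ((ln t - T) / k) / (k * t)"
    have ut: "u x = f t" using x by (simp add: u_def trial_def f_def t_def d_def)
    have "((\<lambda>t. bump ((ln t - T) / k)) has_real_derivative dbump ((ln t - T) / k) * (1 / t / k)) (at t)"
      by (rule DERIV_chain2[OF bump_has_derivative]) (use t k in \<open>auto intro!: derivative_eq_intros\<close>)
    from DERIV_mult[OF ground_has_derivative[OF t(1), of d] this]
    have fd: "(f has_real_derivative g t * f t + e) (at t)"
      by (simp add: f_def[abs_def] e_def g_def mult_ac)
    have pu: "pderiv_i u i x = (g t * f t + e) * pderiv_i r i x" for i
    proof -
      have "pderiv_i u i x = pderiv_i (\<lambda>x. f (r x)) i x"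
        by (rule pderiv_i_cong_open[OF open_Omega x]) (simp add: u_def trial_def f_def d_def)
      also have "\<dots> = (g t * f t + e) * pderiv_i r i x"
        by (rule pderiv_i_compose[where f=r, OF _ r_differentiable[OF x]]) (use fd in \<open>simp add: t_def\<close>)
      finally show ?thesis .
    qed
    have "pderiv_i w i x = 2 * f t * (g t * f t + e) * pderiv_i r i x" for i
      unfolding w_def power2_eq_square
      using pderiv_i_mult[OF Ck_on_1D(1)[OF u0 x] Ck_on_1D(1)[OF u0 x], of i] by (simp add: pu ut algebra_simps)
    then have "(\<Sum>i\<in>UNIV. pderiv_i w i x * chr_field i x) = 2 * f t * (g t * f t + e) * (hdens x * sinh t)"
      using radial_pairing[OF x] by (simp add: mult.assoc sum_distrib_left[symmetric] t_def)
    then have Ix: "I x = (2 * g t * f t * (g t * f t + e) - (f t)\<^sup>2 * (hardy_pot d t + (g t)\<^sup>2)) * hdens x"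
      using t by (simp add: I_def w_def ut t_def[symmetric] field_simps)
    have "hgrad_sq u x = (g t * f t + e)\<^sup>2 * ((defect x / 2)\<^sup>2 * (\<Sum>i\<in>UNIV. (pderiv_i r i x)\<^sup>2))"
      by (simp add: hgrad_sq_eq pu power_mult_distrib sum_distrib_left mult_ac)
    then have gr: "hgrad_sq u x = (g t * f t + e)\<^sup>2" using eikonal[OF x] by simp
    have "e\<^sup>2 = (ground d t)\<^sup>2 * (dbump ((ln t - T) / k))\<^sup>2 / (k * t)\<^sup>2"
      by (simp add: e_def power_divide power_mult_distrib)
    also have "(ground d t)\<^sup>2 = t / sinh t ^ (CARD('n) - 1)"
      unfolding d_def by (rule ground_sq[OF t(1)]) simp
    finally have e2: "e\<^sup>2 * hdens x = 1 / k\<^sup>2 * j x"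
      using x t by (simp add: j_def log_density_def t_def[symmetric] power2_eq_square field_simps)
    have "hgrad_sq u x * hdens x - hardy_pot d (r x) * (u x)\<^sup>2 * hdens x = I x + e\<^sup>2 * hdens x"
      unfolding gr Ix ut t_def[symmetric] by (simp add: power2_eq_square algebra_simps)
    then show ?thesis unfolding e2 .
  next
    case False
    have "pderiv_i w i x = 0" "pderiv_i u i x = 0" for i
      using pderiv_i_eq_0_outside[of K w x i] pderiv_i_eq_0_outside[of K u x i] compact_imp_closed[OF K(1)] wK uK False
      by blast+
    moreover have "j x = 0"
      using log_density_outside[of "\<lambda>s. (dbump s)\<^sup>2", OF z, of x T k] False k by (simp add: j_def K_def)
    ultimately show ?thesis using wK[OF False] uK[OF False] by (simp add: I_def hgrad_sq_def)
  qed
  have "hint (hgrad_sq u) - hint (\<lambda>x. hardy_pot d (r x) * (u x)\<^sup>2)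
      = (\<integral>x. hgrad_sq u x * hdens x - hardy_pot d (r x) * (u x)\<^sup>2 * hdens x \<partial>lborel)"
    unfolding hint_def using integrable_hgrad_sq[OF uT] hardy_inequality(1)[OF uT]
    by (simp add: d_def)
  also have "\<dots> = 1 / k\<^sup>2 * integral\<^sup>L lborel j"
    unfolding eq using I jint by simp
  also have "integral\<^sup>L lborel j = k * dbump_mass"
    using hint_log_density_scale[OF cd z k, of T] by (simp add: j_def[abs_def] hint_def dbump_mass_def)
  finally show ?thesis using k by (simp add: u_def d_def power2_eq_square)
qed

text \<open>If the mass were 0, scaling would make the densities of all stretched bumps vanish
  almost everywhere. Each point of \<Omega> lies where one of them is positive, so \<Omega>, and
  with it the whole ball, would be negligible.\<close>

lemma bump_mass_pos: "0 < bump_mass"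
proof -
  have c: "continuous_on UNIV (\<lambda>s. (bump s)\<^sup>2)" by (intro continuous_intros continuous_on_bump)
  have z: "(bump s)\<^sup>2 = 0" if "1 \<le> \<bar>s\<bar>" for s using bump_eq_0(1)[OF that] by simp
  define f where "f k x = log_density (\<lambda>s. (bump s)\<^sup>2) 0 k x * hdens x" for k x
  have f0: "0 \<le> f k x" for k x
  proof (cases "x \<in> \<Omega>")
    case True
    then have "0 < r x" "0 < sinh (r x)" "0 < hdens x"
      using r_pos sinh_r_pos hdens_pos Omega_subset by auto
    then show ?thesis by (simp add: f_def log_density_def)
  qed (simp add: f_def log_density_def)
  have fi: "integrable lborel (f k)" if "0 < k" for k
    unfolding f_def by (rule integrable_log_density[OF c z that])
  have fk: "integral\<^sup>L lborel (f k) = k * bump_mass" if "0 < k" for k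
    using hint_log_density_scale[OF c z that, of 0] by (simp add: f_def[abs_def] hint_def bump_mass_def)
  have "0 \<le> bump_mass"
    using fk[of 1] Bochner_Integration.integral_nonneg[of lborel "f 1"] f0 by auto
  moreover have "bump_mass \<noteq> 0"
  proof
    assume "bump_mass = 0"
    then have "AE x in lborel. f (real (Suc n)) x = 0" for n
      using integral_nonneg_eq_0_iff_AE[OF fi[of "real (Suc n)"]] fk[of "real (Suc n)"] f0 by simp
    then have "AE x in lborel. \<forall>n. f (real (Suc n)) x = 0"
      by (simp add: AE_all_countable)
    then have "AE x in lborel. x \<notin> \<Omega>"
    proof eventually_elim
      case (elim x)
      show ?case
      proof
        assume x: "x \<in> \<Omega>"
        obtain n where n: "\<bar>ln (r x)\<bar> < real n" using reals_Archimedean2 by blast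
        then have "\<bar>ln (r x) / real (Suc n)\<bar> < 1" by (simp add: abs_divide)
        then have "0 < bump (ln (r x) / real (Suc n))" by (rule bump_pos)
        moreover have "0 < r x" "0 < sinh (r x)" "0 < hdens x"
          using x r_pos sinh_r_pos hdens_pos Omega_subset by auto
        ultimately have "0 < f (real (Suc n)) x" using x by (simp add: f_def log_density_def)
        then show False using elim by (metis less_irrefl)
      qed
    qed
    then have "\<Omega> \<in> null_sets lborel"
      using open_Omega by (simp add: AE_iff_null_sets)
    then have "negligible \<Omega>" using null_sets_completionI negligible_iff_null_sets by blast
    then have "negligible (insert x0 \<Omega>)" by simp
    moreover have "insert x0 \<Omega> = hball" using pole_in_hball by (auto simp: \<Omega>_def)
    ultimately show False using open_not_negligible open_hball pole_in_hball by (metis empty_iff)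
  qed
  ultimately show ?thesis by simp
qed

lemma integrable_trial_sq_div_sinh_sq:
  assumes "0 < k"
  shows "integrable lborel (\<lambda>x. (trial T k x)\<^sup>2 / (sinh (r x))\<^sup>2 * hdens x)"
proof (rule integrable_compact_support[OF log_annulus(1)[of T k]])
  have "continuous_on \<Omega> (trial T k)"
    using Ck_on_imp_continuous_on[OF Ck_on_trial[OF assms, of 0]] by (rule continuous_on_subset) simp
  moreover have "continuous_on \<Omega> (hdens :: real^'n \<Rightarrow> real)"
    using continuous_on_hdens Omega_subset by (rule continuous_on_subset)
  ultimately have "continuous_on \<Omega> (\<lambda>x. (trial T k x)\<^sup>2 / (sinh (r x))\<^sup>2 * hdens x)"
    using r_pos by (intro continuous_intros continuous_on_r) fastforce+
  then show "continuous_on (log_annulus T k) (\<lambda>x. (trial T k x)\<^sup>2 / (sinh (r x))\<^sup>2 * hdens x)"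
    using log_annulus(2) by (rule continuous_on_subset)
qed (use trial_outside[OF _ assms] in auto)

text \<open>The signs of \<open>a\<close> and \<open>b\<close> are free: positive coefficients bound
  the \<open>sinh\<close> integral from below, negative ones bound it from above.\<close>

lemma hint_trial_mono:
  assumes k: "0 < k" and le: "\<And>t. exp (T - k) \<le> t \<Longrightarrow> t \<le> exp (T + k) \<Longrightarrow> a / t\<^sup>2 \<le> b / (sinh t)\<^sup>2"
  shows "a * hint (\<lambda>x. (trial T k x)\<^sup>2 / (r x)\<^sup>2) \<le> b * hint (\<lambda>x. (trial T k x)\<^sup>2 / (sinh (r x))\<^sup>2)"
proof -
  have "a * ((trial T k x)\<^sup>2 / (r x)\<^sup>2 * hdens x) \<le> b * ((trial T k x)\<^sup>2 / (sinh (r x))\<^sup>2 * hdens x)" for x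
  proof (cases "x \<in> log_annulus T k")
    case True
    then have "x \<in> hball" "a / (r x)\<^sup>2 \<le> b / (sinh (r x))\<^sup>2" by (auto simp: log_annulus_def intro!: le)
    then have "a / (r x)\<^sup>2 * ((trial T k x)\<^sup>2 * hdens x) \<le> b / (sinh (r x))\<^sup>2 * ((trial T k x)\<^sup>2 * hdens x)"
      using hdens_pos[of x] by (intro mult_right_mono) auto
    then show ?thesis by simp
  qed (use trial_outside[OF _ k] in auto)
  then have "(\<integral>x. a * ((trial T k x)\<^sup>2 / (r x)\<^sup>2 * hdens x) \<partial>lborel)
      \<le> (\<integral>x. b * ((trial T k x)\<^sup>2 / (sinh (r x))\<^sup>2 * hdens x) \<partial>lborel)"
    using hint_trial_sq_div_r_sq(2)[OF k] integrable_trial_sq_div_sinh_sq[OF k]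
    by (intro integral_mono integrable_mult_right) auto
  then show ?thesis unfolding hint_def integral_mult_right_zero .
qed

lemma trial_balance:
  assumes "0 < k"
  defines "d \<equiv> real CARD('n)"
  shows "hint (hgrad_sq (trial T k)) - (d - 1)\<^sup>2 / 4 * hint (\<lambda>x. (trial T k x)\<^sup>2)
    = dbump_mass / k + 1 / 4 * hint (\<lambda>x. (trial T k x)\<^sup>2 / (r x)\<^sup>2)
      + (d - 1) * (d - 3) / 4 * hint (\<lambda>x. (trial T k x)\<^sup>2 / (sinh (r x))\<^sup>2)"
  using trial_energy[OF assms(1), of T] hint_hardy_pot[OF trial_in_test_funs_Omega(2)[OF assms(1), of T]]
  by (simp add: d_def)

section \<open>Optimality of the constants and criticality\<close>

lemma eventually_energy_less:
  assumes "0 < \<delta>"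
  shows "\<forall>\<^sub>F k in at_top. dbump_mass / k < \<delta> * (k * bump_mass)"
proof -
  have "\<forall>\<^sub>F k in at_top. dbump_mass / k < (\<delta> * bump_mass) * k"
    using assms bump_mass_pos mult_pos_pos[OF assms bump_mass_pos] by real_asymp
  then show ?thesis by (simp add: mult_ac)
qed

theorem hardy_constant_optimal:
  assumes c: "1 / 4 < c"
  defines "d \<equiv> real CARD('n)"
  shows "\<exists>u\<in>test_funs hball. hint (hgrad_sq u) - (d - 1)\<^sup>2 / 4 * hint (\<lambda>x. (u x)\<^sup>2)
    < c * hint (\<lambda>x. (u x)\<^sup>2 / (r x)\<^sup>2)"
proof -
  define \<kappa> where "\<kappa> = (d - 1) * (d - 3) / 4"
  \<comment> \<open>One half of the excess over \<open>1 / 4\<close> pays for the energy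
    \<open>dbump_mass / k\<close>, the other half for the \<open>sinh\<close> term.\<close>
  define \<delta> where "\<delta> = (c - 1 / 4) / 2"
  have \<delta>: "0 < \<delta>" using c by (simp add: \<delta>_def)
  have "((\<lambda>t::real. \<kappa> * (t\<^sup>2 / (sinh t)\<^sup>2)) \<longlongrightarrow> \<kappa> * 0) at_top"
    by (intro tendsto_mult tendsto_const) real_asymp
  then have "\<forall>\<^sub>F t in at_top. \<kappa> * (t\<^sup>2 / (sinh t)\<^sup>2) < \<delta>"
    using \<delta> by (intro order_tendstoD(2)) auto
  then obtain M where M: "\<And>t. M \<le> t \<Longrightarrow> \<kappa> * (t\<^sup>2 / (sinh t)\<^sup>2) < \<delta>"
    by (auto simp: eventually_at_top_linorder)
  have "\<forall>\<^sub>F k::real in at_top. M \<le> exp k"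
    using filterlim_at_top[THEN iffD1, OF exp_at_top] by auto
  then have "\<forall>\<^sub>F k in at_top. 0 < k \<and> M \<le> exp k \<and> dbump_mass / k < \<delta> * (k * bump_mass)"
    using eventually_gt_at_top[of 0] eventually_energy_less[OF \<delta>] by eventually_elim auto
  then obtain k where k: "0 < k" "M \<le> exp k" "dbump_mass / k < \<delta> * (k * bump_mass)"
    by (auto dest: eventually_happens)
  \<comment> \<open>The support is \<open>k \<le> ln r \<le> 3 * k\<close>, so
    \<open>r \<ge> exp k\<close> escapes to infinity, where \<open>1 / (sinh r)^2\<close> is
    negligible against \<open>1 / r^2\<close>, while the Hardy term still grows like
    \<open>k\<close>.\<close>
  define u where "u = trial (2 * k) k"
  define X where "X = hint (\<lambda>x. (u x)\<^sup>2 / (r x)\<^sup>2)"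
  define Z where "Z = hint (\<lambda>x. (u x)\<^sup>2 / (sinh (r x))\<^sup>2)"
  have X: "X = k * bump_mass" using hint_trial_sq_div_r_sq(1)[OF k(1)] by (simp add: X_def u_def)
  have "(- \<delta>) * X \<le> (- \<kappa>) * Z"
    unfolding X_def Z_def u_def
  proof (rule hint_trial_mono[OF k(1)])
    fix t assume "exp (2 * k - k) \<le> t" "t \<le> exp (2 * k + k)"
    then have t: "exp k \<le> t" by simp
    then have "0 < t" using exp_gt_zero[of k] by linarith
    moreover from this have "0 < sinh t" by simp
    moreover have "\<kappa> * (t\<^sup>2 / (sinh t)\<^sup>2) < \<delta>" using M t k(2) by auto
    ultimately show "- \<delta> / t\<^sup>2 \<le> - \<kappa> / (sinh t)\<^sup>2" by (simp add: field_simps)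
  qed
  then have "dbump_mass / k + 1 / 4 * X + \<kappa> * Z < \<delta> * X + 1 / 4 * X + \<delta> * X"
    using k(3) by (simp add: X)
  also have "\<dots> = c * X" by (simp add: \<delta>_def field_simps)
  finally have "hint (hgrad_sq u) - (d - 1)\<^sup>2 / 4 * hint (\<lambda>x. (u x)\<^sup>2) < c * X"
    using trial_balance[OF k(1), of "2 * k"] by (simp add: u_def X_def Z_def \<kappa>_def d_def)
  then show ?thesis
    unfolding X_def u_def using trial_in_test_funs_Omega(2)[OF k(1)] by blast
qed

theorem sinh_constant_optimal:
  assumes \<epsilon>: "0 < \<epsilon>" and c: "(real CARD('n) - 1) * (real CARD('n) - 3) / 4 < c"
  defines "d \<equiv> real CARD('n)"
  shows "\<exists>u\<in>test_funs {x\<in>hball. r x < \<epsilon>}. hint (hgrad_sq u) - (d - 1)\<^sup>2 / 4 * hint (\<lambda>x. (u x)\<^sup>2)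
    < 1 / 4 * hint (\<lambda>x. (u x)\<^sup>2 / (r x)\<^sup>2) + c * hint (\<lambda>x. (u x)\<^sup>2 / (sinh (r x))\<^sup>2)"
proof -
  define \<kappa> where "\<kappa> = (d - 1) * (d - 3) / 4"
  \<comment> \<open>The halving compensates the constant \<open>1 / 2\<close> in the comparison of
    \<open>1 / r^2\<close> with \<open>1 / (sinh r)^2\<close> below: \<delta> times the Hardy
    integral is at most \<open>c - \<kappa>\<close> times the \<open>sinh\<close> integral.\<close>
  define \<delta> where "\<delta> = (c - \<kappa>) / 2"
  have \<delta>: "0 < \<delta>" using c by (simp add: \<delta>_def \<kappa>_def d_def)
  have "((\<lambda>t::real. t\<^sup>2 / (sinh t)\<^sup>2) \<longlongrightarrow> 1) (at_right 0)" by real_asymp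
  then have "\<forall>\<^sub>F t::real in at_right 0. 1 / 2 < t\<^sup>2 / (sinh t)\<^sup>2"
    by (rule order_tendstoD(1)) simp
  then obtain M where M: "0 < M" "\<And>t::real. 0 < t \<Longrightarrow> t < M \<Longrightarrow> 1 / 2 < t\<^sup>2 / (sinh t)\<^sup>2"
    by (auto simp: eventually_at_right_field)
  have "\<forall>\<^sub>F k::real in at_top. exp (- k) < min M \<epsilon>"
    using M(1) \<epsilon> by (intro order_tendstoD(2)[of _ 0]) (real_asymp, simp)
  then have "\<forall>\<^sub>F k in at_top. 0 < k \<and> exp (- k) < min M \<epsilon> \<and> dbump_mass / k < \<delta> * (k * bump_mass)"
    using eventually_gt_at_top[of 0] eventually_energy_less[OF \<delta>] by eventually_elim auto
  then obtain k where k: "0 < k" "exp (- k) < min M \<epsilon>" "dbump_mass / k < \<delta> * (k * bump_mass)"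
    by (auto dest: eventually_happens)
  \<comment> \<open>The support is \<open>- 3 * k \<le> ln r \<le> - k\<close>, so
    \<open>r \<le> exp (- k)\<close> is small enough both for that comparison and for lying in the
    ball of radius \<epsilon>.\<close>
  define u where "u = trial (- 2 * k) k"
  define X where "X = hint (\<lambda>x. (u x)\<^sup>2 / (r x)\<^sup>2)"
  define Z where "Z = hint (\<lambda>x. (u x)\<^sup>2 / (sinh (r x))\<^sup>2)"
  have X: "X = k * bump_mass" using hint_trial_sq_div_r_sq(1)[OF k(1)] by (simp add: X_def u_def)
  have "(1 / 2) * X \<le> 1 * Z"
    unfolding X_def Z_def u_def
  proof (rule hint_trial_mono[OF k(1)])
    fix t assume t: "exp (- 2 * k - k) \<le> t" "t \<le> exp (- 2 * k + k)"
    have "0 < t" using t(1) exp_gt_zero[of "- 2 * k - k"] by linarith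
    moreover from this have "0 < sinh t" by simp
    moreover have "t < M" using t(2) k(2) by simp
    ultimately show "1 / 2 / t\<^sup>2 \<le> 1 / (sinh t)\<^sup>2" using M(2)[of t] by (simp add: field_simps)
  qed
  then have "\<delta> * X \<le> \<delta> * (2 * Z)" using \<delta> by (intro mult_left_mono) auto
  then have "dbump_mass / k + 1 / 4 * X + \<kappa> * Z < \<delta> * (2 * Z) + 1 / 4 * X + \<kappa> * Z"
    using k(3) by (simp add: X)
  also have "\<dots> = 1 / 4 * X + c * Z" by (simp add: \<delta>_def field_simps)
  finally have "hint (hgrad_sq u) - (d - 1)\<^sup>2 / 4 * hint (\<lambda>x. (u x)\<^sup>2) < 1 / 4 * X + c * Z"
    using trial_balance[OF k(1), of "- 2 * k"] by (simp add: u_def X_def Z_def \<kappa>_def d_def)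
  moreover have "u \<in> test_funs {x\<in>hball. r x < \<epsilon>}"
    unfolding u_def by (rule trial_in_test_funs[OF k(1)]) (use k(2) in \<open>auto simp: log_annulus_def\<close>)
  ultimately show ?thesis unfolding X_def Z_def by blast
qed

text \<open>The truncations centred at 0 form a null sequence: their energies tend to 0 while they
  increase pointwise, each point of \<Omega> lying in the positivity set of all late ones. A weight
  controlled by these energies must vanish almost everywhere.\<close>

theorem hardy_operator_critical: "critical \<Omega> (\<lambda>x. hardy_pot (real CARD('n)) (r x))"
  unfolding critical_def
proof (intro conjI ballI notI)
  fix u assume "u \<in> test_funs \<Omega>"
  then have "u \<in> test_funs hball" using Omega_subset by (auto simp: test_funs_def)
  from hardy_inequality(2)[OF this]
  show "0 \<le> hQ (\<lambda>x. hardy_pot (real CARD('n)) (r x)) u" by (simp add: hQ_def hint_def)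
next
  assume "\<exists>W. W \<in> borel_measurable lborel \<and> (\<forall>x\<in>\<Omega>. 0 \<le> W x) \<and>
      \<not> (AE x in lborel. x \<in> \<Omega> \<longrightarrow> W x = 0) \<and>
      (\<forall>u\<in>test_funs \<Omega>. (\<integral>\<^sup>+ x. ennreal (W x * (u x)\<^sup>2 * hdens x) \<partial>lborel)
        \<le> ennreal (hQ (\<lambda>x. hardy_pot (real CARD('n)) (r x)) u))"
  then obtain W where W: "W \<in> borel_measurable lborel" "\<And>x. x \<in> \<Omega> \<Longrightarrow> 0 \<le> W x"
    "\<not> (AE x in lborel. x \<in> \<Omega> \<longrightarrow> W x = 0)"
    "\<And>u. u \<in> test_funs \<Omega> \<Longrightarrow> (\<integral>\<^sup>+ x. ennreal (W x * (u x)\<^sup>2 * hdens x) \<partial>lborel)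
        \<le> ennreal (hQ (\<lambda>x. hardy_pot (real CARD('n)) (r x)) u)" by blast
  define f where "f n x = W x * (trial 0 (real (Suc n)) x)\<^sup>2 * hdens x" for n x
  have up: "(\<integral>\<^sup>+ x. ennreal (f n x) \<partial>lborel) \<le> ennreal (dbump_mass / real (Suc n))" for n
    using W(4)[OF trial_in_test_funs_Omega(1), of "real (Suc n)" 0] trial_energy[of "real (Suc n)" 0]
    by (simp add: f_def hQ_def)
  have mono: "f m x \<le> f n x" if "m \<le> n" for m n x
  proof (cases "x \<in> \<Omega>")
    case True
    have "\<bar>ln (r x) / real (Suc n)\<bar> \<le> \<bar>ln (r x) / real (Suc m)\<bar>"
      using that unfolding abs_divide by (intro divide_left_mono) auto
    then have "trial 0 (real (Suc m)) x \<le> trial 0 (real (Suc n)) x"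
      using True ground_pos[of "real CARD('n)" "r x"] bump_antimono by (simp add: trial_def)
    moreover have "0 \<le> trial 0 (real (Suc m)) x"
      using True ground_pos[of "real CARD('n)" "r x"] bump_nonneg by (simp add: trial_def)
    ultimately show ?thesis
      unfolding f_def using W(2)[OF True] hdens_pos[of x] True Omega_subset
      by (intro mult_right_mono mult_left_mono power_mono) auto
  qed (simp add: f_def trial_def)
  have zero: "(\<integral>\<^sup>+ x. ennreal (f n x) \<partial>lborel) = 0" for n
  proof -
    have "(\<lambda>m. dbump_mass / real (Suc m)) \<longlonglongrightarrow> 0" by real_asymp
    then have "(\<lambda>m. ennreal (dbump_mass / real (Suc m))) \<longlonglongrightarrow> ennreal 0"
      by (rule tendsto_ennrealI)
    \<comment> \<open>Monotonicity bounds the integral for a fixed \<open>n\<close> by those of all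
      later truncations, so it vanishes itself and not just in the limit.\<close>
    moreover have "\<exists>M. \<forall>m\<ge>M. (\<integral>\<^sup>+ x. ennreal (f n x) \<partial>lborel) \<le> ennreal (dbump_mass / real (Suc m))"
    proof (intro exI[of _ n] allI impI)
      fix m assume "n \<le> m"
      then have "(\<integral>\<^sup>+ x. ennreal (f n x) \<partial>lborel) \<le> (\<integral>\<^sup>+ x. ennreal (f m x) \<partial>lborel)"
        by (intro nn_integral_mono ennreal_leI mono)
      also note up
      finally show "(\<integral>\<^sup>+ x. ennreal (f n x) \<partial>lborel) \<le> ennreal (dbump_mass / real (Suc m))" .
    qed
    ultimately have "(\<integral>\<^sup>+ x. ennreal (f n x) \<partial>lborel) \<le> ennreal 0"
      by (rule LIMSEQ_le_const)
    then show ?thesis by simp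
  qed
  have fm: "f n \<in> borel_measurable lborel" for n
  proof -
    have "trial 0 (real (Suc n)) \<in> borel_measurable borel"
      using Ck_on_imp_continuous_on[OF Ck_on_trial[of "real (Suc n)" 0 0]]
      by (intro borel_measurable_continuous_onI) simp
    then show ?thesis
      unfolding f_def using W(1) hdens_measurable
      by (intro borel_measurable_times borel_measurable_power) auto
  qed
  have "AE x in lborel. ennreal (f n x) = 0" for n
    using zero[of n] fm[of n] by (subst (asm) nn_integral_0_iff_AE) auto
  then have "AE x in lborel. \<forall>n. ennreal (f n x) = 0"
    by (simp add: AE_all_countable)
  then have "AE x in lborel. x \<in> \<Omega> \<longrightarrow> W x = 0"
  proof eventually_elim
    case (elim x)
    show ?case
    proof
      assume x: "x \<in> \<Omega>"
      obtain n where n: "\<bar>ln (r x)\<bar> < real n" using reals_Archimedean2 by blast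
      then have "\<bar>ln (r x) / real (Suc n)\<bar> < 1" by (simp add: abs_divide)
      then have "0 < bump (ln (r x) / real (Suc n))" by (rule bump_pos)
      then have "0 < trial 0 (real (Suc n)) x"
        using x ground_pos[of "real CARD('n)" "r x"] by (simp add: trial_def)
      moreover have "0 < hdens x" using x hdens_pos Omega_subset by auto
      ultimately have "0 < (trial 0 (real (Suc n)) x)\<^sup>2 * hdens x" by simp
      moreover have "f n x \<le> 0" using elim by (simp add: ennreal_eq_0_iff)
      ultimately have "W x \<le> 0"
        unfolding f_def mult.assoc by (meson linorder_not_le mult_pos_pos)
      then show "W x = 0" using W(2)[OF x] by simp
    qed
  qed
  then show False using W(3) by blast
qed

end

theorem theorem2p1:
  fixes x0 :: "real^'n"
  assumes N3: "CARD('n) \<ge> 3"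
    and o_in: "x0 \<in> hball"
  defines "N \<equiv> real CARD('n)"
  defines "r \<equiv> (\<lambda>x. hdist x x0)"
  shows
    "(\<forall>u\<in>test_funs hball.
        hint (hgrad_sq u) - (N - 1)^2 / 4 * hint (\<lambda>x. (u x)^2)
          \<ge> 1/4 * hint (\<lambda>x. (u x)^2 / (r x)^2)
            + (N - 1) * (N - 3) / 4 * hint (\<lambda>x. (u x)^2 / (sinh (r x))^2))
     \<and> critical (hball - {x0})
         (\<lambda>x. (N - 1)^2 / 4 + 1 / (4 * (r x)^2) + (N - 1) * (N - 3) / 4 / (sinh (r x))^2)
     \<and> (\<forall>c > 1/4. \<not> (\<forall>u\<in>test_funs hball.
            hint (hgrad_sq u) - (N - 1)^2 / 4 * hint (\<lambda>x. (u x)^2)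
              \<ge> c * hint (\<lambda>x. (u x)^2 / (r x)^2)))
     \<and> (\<forall>\<epsilon> > 0. \<forall>c > (N - 1) * (N - 3) / 4. \<not> (\<forall>u\<in>test_funs {x\<in>hball. r x < \<epsilon>}.
            hint (hgrad_sq u) - (N - 1)^2 / 4 * hint (\<lambda>x. (u x)^2)
              \<ge> 1/4 * hint (\<lambda>x. (u x)^2 / (r x)^2)
                + c * hint (\<lambda>x. (u x)^2 / (sinh (r x))^2)))"
proof -
  interpret P: hyperbolic_pole x0
    by unfold_locales (use N3 o_in in auto)
  have r: "r = P.r"
    by (simp add: fun_eq_iff P.r_def r_def)
  show ?thesis
    unfolding r N_def
  proof (intro conjI ballI allI impI)
    fix u :: "real^'n \<Rightarrow> real" assume u: "u \<in> test_funs hball"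
    have "hint (\<lambda>x. hardy_pot (real CARD('n)) (P.r x) * (u x)\<^sup>2) \<le> hint (hgrad_sq u)"
      using P.hardy_inequality(2)[OF u] by (simp add: hint_def)
    then show "hint (hgrad_sq u) - (real CARD('n) - 1)^2 / 4 * hint (\<lambda>x. (u x)^2)
          \<ge> 1/4 * hint (\<lambda>x. (u x)^2 / (P.r x)^2)
            + (real CARD('n) - 1) * (real CARD('n) - 3) / 4 * hint (\<lambda>x. (u x)^2 / (sinh (P.r x))^2)"
      unfolding P.hint_hardy_pot[OF u] by linarith
  next
    show "critical (hball - {x0}) (\<lambda>x. (real CARD('n) - 1)^2 / 4 + 1 / (4 * (P.r x)^2)
        + (real CARD('n) - 1) * (real CARD('n) - 3) / 4 / (sinh (P.r x))^2)"
      using P.hardy_operator_critical unfolding hardy_pot_def P.\<Omega>_def .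
  qed (use P.hardy_constant_optimal P.sinh_constant_optimal in \<open>meson linorder_not_le\<close>)+
qed

end
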